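(* Let $N \geq 3$, $p \in (1,N)$ and $p^*=\frac{Np}{N-p}$. Then there exists $C>0$ such that, for all $u \in \mathcal{D}^{1,p}_0(\mathbb{R}^N)$ with $\|u\|_{L^{p^*,p}}=1$, $$\int_0^{\infty} s^{\frac{p}{p^*}-1} |u^*(s)|^p \log \left(s^{1-\frac{p}{N}} |u^*(s)|^p \right) ds \leq \frac{N}{p} \log \left(C \int_{\mathbb{R}^N} |\nabla u|^p \, dx \right).$$
   Context: $\mathcal{D}^{1,p}_0(\mathbb{R}^N)$ is the Beppo-Levi space: the completion of $C_c^\infty(\mathbb{R}^N)$ with respect to the norm $\left[\int_{\mathbb{R}^N} |\nabla u|^p\,dx\right]^{1/p}$ (for $1<p<N$ its elements are identified with functions in $L^{p^*}(\mathbb{R}^N)$ via the Sobolev inequality). For a measurable $f:\mathbb{R}^N\to\mathbb{R}$, let $\alpha_f(s)=|\{x:|f(x)|>s\}|$ for $s>0$ (Lebesgue measure), and let $f^*$ be its one-dimensional decreasing rearrangement: $f^*(0)=\operatorname{ess\,sup}|f|$ and $f^*(t)=\inf\{s>0:\alpha_f(s)<t\}$ for $t>0$. The Lorentz quasi-norm used is $$\|f\|_{L^{p^*,p}}=\left(\int_0^\infty \left[t^{\frac{1}{p^*}-\frac1p} f^*(t)\right]^p dt\right)^{1/p}.$$ The convention $0\log 0=0$ is used, and the integral on the left-hand side is understood as an extended real number (it may equal $-\infty$). *)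

theory Defs
  imports "HOL-Analysis.Analysis" "HOL-Probability.Essential_Supremum"
begin

definition grad :: "(real ^ 'n \<Rightarrow> real) \<Rightarrow> real ^ 'n \<Rightarrow> real ^ 'n" where
  "grad f x = (\<chi> i. frechet_derivative f (at x) (axis i 1))"

(* f is of class C^(k+1) iff it is differentiable and all its first partial
   derivatives are of class C^k. *)
primrec C_k :: "nat \<Rightarrow> (real ^ 'n \<Rightarrow> real) \<Rightarrow> bool" where
  "C_k 0 f \<longleftrightarrow> continuous_on UNIV f"
| "C_k (Suc k) f \<longleftrightarrow> (\<forall>x. f differentiable (at x)) \<and> (\<forall>i. C_k k (\<lambda>x. grad f x $ i))"

definition test_functions :: "(real ^ 'n \<Rightarrow> real) set" where
  "test_functions = {f. (\<forall>k. C_k k f) \<and> compact (closure {x. f x \<noteq> 0})}"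

(* Power of an extended nonnegative number, meant for exponents a > 0 (so that the
   a-th power of infinity is infinity, and 0 powr a = 0). *)
definition ennreal_powr :: "ennreal \<Rightarrow> real \<Rightarrow> ennreal" where
  "ennreal_powr x a = (if x = \<infinity> then \<infinity> else ennreal (enn2real x powr a))"

definition Lp_norm :: "real \<Rightarrow> (real ^ 'n \<Rightarrow> 'b::real_normed_vector) \<Rightarrow> ennreal" where
  "Lp_norm p f = ennreal_powr (\<integral>\<^sup>+x. ennreal (norm (f x) powr p) \<partial>lebesgue) (1 / p)"

definition sobolev_exponent :: "nat \<Rightarrow> real \<Rightarrow> real" where
  "sobolev_exponent N p = real N * p / (real N - p)"

(* The completion of the test functions in the norm Lp_norm p (grad f), for
   1 < p < N. By the Sobolev inequality a sequence that is Cauchy in this norm converges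
   in L^(p-star), and equivalent Cauchy sequences have the same limit; an element of the
   completion is identified with that limit. All representatives of an almost-everywhere
   class are included. *)
definition beppo_levi :: "real \<Rightarrow> (real ^ 'n \<Rightarrow> real) set" where
  "beppo_levi p = {u. u \<in> borel_measurable lebesgue \<and>
     Lp_norm (sobolev_exponent CARD('n) p) u < \<infinity> \<and>
     (\<exists>\<phi>. range \<phi> \<subseteq> test_functions \<and>
       (\<forall>e>0. \<exists>M. \<forall>m\<ge>M. \<forall>n\<ge>M. Lp_norm p (grad (\<lambda>x. \<phi> m x - \<phi> n x)) < ennreal e) \<and>
       (\<lambda>k. Lp_norm (sobolev_exponent CARD('n) p) (\<lambda>x. \<phi> k x - u x)) \<longlonglongrightarrow> 0)}"

(* G is the gradient of the element u of the completion: the operator grad from the test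
   functions into L^p is isometric and is extended to the completion by continuity.
   G is determined by u up to a null set, and it is the distributional gradient of u. *)
definition has_gradient :: "real \<Rightarrow> (real ^ 'n \<Rightarrow> real) \<Rightarrow> (real ^ 'n \<Rightarrow> real ^ 'n) \<Rightarrow> bool" where
  "has_gradient p u G \<longleftrightarrow> G \<in> borel_measurable lebesgue \<and>
     (\<exists>\<phi>. range \<phi> \<subseteq> test_functions \<and>
       (\<lambda>k. Lp_norm p (\<lambda>x. grad (\<phi> k) x - G x)) \<longlonglongrightarrow> 0 \<and>
       (\<lambda>k. Lp_norm (sobolev_exponent CARD('n) p) (\<lambda>x. \<phi> k x - u x)) \<longlonglongrightarrow> 0)"

definition distribution_fun :: "(real ^ 'n \<Rightarrow> real) \<Rightarrow> real \<Rightarrow> ennreal" where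
  "distribution_fun f s = emeasure lebesgue {x. \<bar>f x\<bar> > s}"

(* Meant for t \<ge> 0; the infimum of the empty set is infinity. *)
definition rearrangement :: "(real ^ 'n \<Rightarrow> real) \<Rightarrow> real \<Rightarrow> ennreal" where
  "rearrangement f t =
     (if t = 0 then esssup lebesgue (\<lambda>x. ennreal \<bar>f x\<bar>)
      else Inf {ennreal s | s. s > 0 \<and> distribution_fun f s < ennreal t})"

definition lorentz_norm :: "real \<Rightarrow> real \<Rightarrow> (real ^ 'n \<Rightarrow> real) \<Rightarrow> ennreal" where
  "lorentz_norm q p f = ennreal_powr
     (\<integral>\<^sup>+t\<in>{0<..}. ennreal_powr (ennreal (t powr (1 / q - 1 / p)) * rearrangement f t) p \<partial>lborel)
     (1 / p)"

(* Integral as an extended real number: positive part minus negative part.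
   In ereal, infinity - infinity = infinity, so an upper bound by a real number also
   asserts that the integral of the positive part is finite. *)
definition ext_integral :: "real set \<Rightarrow> (real \<Rightarrow> real) \<Rightarrow> ereal" where
  "ext_integral A g = enn2ereal (\<integral>\<^sup>+s\<in>A. ennreal (g s) \<partial>lborel)
                    - enn2ereal (\<integral>\<^sup>+s\<in>A. ennreal (- g s) \<partial>lborel)"

(* For u in L^(p-star) the rearrangement is finite on s > 0, so enn2real loses nothing
   there. Where it vanishes the integrand is 0 * ln 0 = 0, as 0 log 0 = 0 requires. *)
definition log_integrand :: "nat \<Rightarrow> real \<Rightarrow> (real ^ 'n \<Rightarrow> real) \<Rightarrow> real \<Rightarrow> real" where
  "log_integrand N p u s =
     s powr (p / sobolev_exponent N p - 1) * \<bar>enn2real (rearrangement u s)\<bar> powr p *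
     ln (s powr (1 - p / real N) * \<bar>enn2real (rearrangement u s)\<bar> powr p)"

end

theory Submission
  imports Defs
begin

text \<open>Write \<open>v\<close> for the rearrangement of \<open>u\<close>, \<open>n\<close> for the dimension and \<open>q\<close> for the Sobolev exponent, and
put \<open>w s = s powr (p / q - 1) * v s powr p\<close>. The normalization of \<open>u\<close> says that \<open>w\<close> is a
probability density on the positive half-line, and the integrand on the left-hand side is
\<open>w s * ln (s * w s)\<close>, because \<open>p / q = 1 - p / n\<close>. With \<open>a = p / (n - p)\<close> the exponents match so
that \<open>(s * w s) powr a * w s = v s powr q\<close>. Jensen's inequality for the logarithm therefore
bounds the left-hand side by \<open>1 / a\<close> times the logarithm of the integral of \<open>v powr q\<close>. That
integral is at most the integral of \<open>\<bar>u\<bar> powr q\<close> (\<open>rearrangement_power_integral_le\<close>), which the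
Sobolev inequality bounds by a constant times the power \<open>q / p\<close> of the integral of
\<open>norm G powr p\<close>. Since \<open>1 / a * (q / p) = n / p\<close>, this is the claim. So the logarithmic
inequality in Lorentz form rests on the Sobolev inequality in its usual form alone.

The Sobolev inequality is proved by the method of Gagliardo and Nirenberg. On a coordinate line,
a power of a test function is bounded by the integral of its derivative; the product of these
bounds over all coordinate directions is integrated by an inequality of the Loomis--Whitney type
(\<open>grid_lines\<close>), proved by induction on the coordinates with Hoelder's inequality. A suitable
choice of the power and one more application of Hoelder's inequality give the inequality
for test functions (\<open>Sobolev_test_function\<close>), and approximation extends it to the completion
(\<open>Sobolev_inequality\<close>).\<close>

section \<open>Powers of extended nonnegative numbers and Hoelder's inequality\<close>

text \<open>The convention \<open>x\<^sup>0 = 1\<close>, also at \<open>x = 0\<close> and \<open>x = \<infinity>\<close>, is what makes exponents add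
and lets a factor with exponent zero disappear from a product; in the induction for
\<open>grid_lines\<close> such a factor occurs at the outermost stage.\<close>
definition epow :: "ennreal \<Rightarrow> real \<Rightarrow> ennreal" where
  "epow x a = (if a = 0 then 1 else ennreal_powr x a)"

lemma epow_0 [simp]: "epow x 0 = 1" by (simp add: epow_def)

lemma epow_ennreal: "a \<noteq> 0 \<Longrightarrow> 0 \<le> r \<Longrightarrow> epow (ennreal r) a = ennreal (r powr a)"
  by (simp add: epow_def ennreal_powr_def)

lemma epow_top: "a \<noteq> 0 \<Longrightarrow> epow top a = top"
  by (simp add: epow_def ennreal_powr_def)

lemma epow_one [simp]: "epow x 1 = x"
  by (cases x) (auto simp: epow_top epow_ennreal)

lemma epow_add: "0 \<le> a \<Longrightarrow> 0 \<le> b \<Longrightarrow> epow x (a + b) = epow x a * epow x b"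
  by (cases "a = 0 \<or> b = 0"; cases x)
     (auto simp: epow_top epow_ennreal powr_add ennreal_mult ennreal_mult_top)

lemma epow_mono: "0 \<le> a \<Longrightarrow> x \<le> y \<Longrightarrow> epow x a \<le> epow y a"
  by (cases "a = 0"; cases x; cases y)
     (auto simp: epow_top epow_ennreal intro!: ennreal_leI powr_mono2 simp: top_unique)

lemma epow_measurable [measurable (raw)]:
  assumes [measurable]: "f \<in> borel_measurable M"
  shows "(\<lambda>x. epow (f x) a) \<in> borel_measurable M"
  unfolding epow_def ennreal_powr_def by measurable

lemma epow_eq_0: "0 < a \<Longrightarrow> epow x a = 0 \<longleftrightarrow> x = 0"
  by (cases x) (auto simp: epow_top epow_ennreal)

text \<open>Convexity of the exponential function at the points \<open>ln (x j)\<close>.\<close>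
lemma weighted_AM_GM_real:
  fixes a x :: "'j \<Rightarrow> real"
  assumes "finite J" "\<And>j. j \<in> J \<Longrightarrow> 0 \<le> a j" "sum a J = 1" "\<And>j. j \<in> J \<Longrightarrow> 0 < x j"
  shows "(\<Prod>j\<in>J. x j powr a j) \<le> (\<Sum>j\<in>J. a j * x j)"
proof -
  have "J \<noteq> {}" using assms by auto
  have "exp (\<Sum>j\<in>J. a j *\<^sub>R ln (x j)) \<le> (\<Sum>j\<in>J. a j * exp (ln (x j)))"
    by (rule convex_on_sum[OF \<open>finite J\<close> \<open>J \<noteq> {}\<close> exp_convex]) (use assms in auto)
  also have "\<dots> = (\<Sum>j\<in>J. a j * x j)" using assms by (intro sum.cong) auto
  also have "exp (\<Sum>j\<in>J. a j *\<^sub>R ln (x j)) = (\<Prod>j\<in>J. x j powr a j)"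
    using assms(1) by (auto simp: exp_sum powr_def dest!: assms(4) intro!: prod.cong)
  finally show ?thesis .
qed

lemma weighted_AM_GM:
  fixes a :: "'j \<Rightarrow> real" and x :: "'j \<Rightarrow> ennreal"
  assumes fin: "finite J" and a0: "\<And>j. j \<in> J \<Longrightarrow> 0 \<le> a j" and a1: "sum a J = 1"
  shows "(\<Prod>j\<in>J. epow (x j) (a j)) \<le> (\<Sum>j\<in>J. ennreal (a j) * x j)"
proof -
  \<comment> \<open>Indices of weight zero contribute nothing to either side; the others can be
    treated according to whether some value is infinite or zero.\<close>
  define P where "P = {j \<in> J. a j \<noteq> 0}"
  have P: "finite P" "P \<subseteq> J" "\<And>j. j \<in> P \<Longrightarrow> 0 < a j" using fin a0 by (auto simp: P_def less_le)
  have "sum a P = 1" unfolding a1[symmetric] using fin by (intro sum.mono_neutral_left) (auto simp: P_def)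
  have L: "(\<Prod>j\<in>J. epow (x j) (a j)) = (\<Prod>j\<in>P. epow (x j) (a j))"
    using fin by (intro prod.mono_neutral_right) (auto simp: P_def)
  have R: "(\<Sum>j\<in>J. ennreal (a j) * x j) = (\<Sum>j\<in>P. ennreal (a j) * x j)"
    using fin by (intro sum.mono_neutral_right) (auto simp: P_def)
  consider (top) j where "j \<in> P" "x j = \<infinity>" | (zero) j where "j \<in> P" "x j = 0"
    | (pos) "\<And>j. j \<in> P \<Longrightarrow> x j \<noteq> \<infinity> \<and> x j \<noteq> 0" by blast
  then show ?thesis
  proof cases
    case top
    then have "(\<Sum>j\<in>P. ennreal (a j) * x j) = \<infinity>"
      using P by (force simp: ennreal_mult_top dest: P(3) intro!: bexI[of _ j])
    then show ?thesis by (simp add: R)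
  next
    case zero
    then have z: "(\<Prod>j\<in>P. epow (x j) (a j)) = 0"
      using P by (intro prod_zero bexI[of _ j]) (auto simp: epow_eq_0)
    show ?thesis unfolding L z by simp
  next
    case pos
    define r where "r j = enn2real (x j)" for j
    have r: "x j = ennreal (r j)" "0 < r j" if "j \<in> P" for j
      using pos[OF that] by (auto simp: r_def enn2real_positive_iff less_top[symmetric] zero_less_iff_neq_zero)
    have "epow (x j) (a j) = ennreal (r j powr a j)" if "j \<in> P" for j
      using r[OF that] P(3)[OF that] by (simp add: epow_ennreal)
    then have "(\<Prod>j\<in>P. epow (x j) (a j)) = (\<Prod>j\<in>P. ennreal (r j powr a j))" by simp
    also have "\<dots> = ennreal (\<Prod>j\<in>P. r j powr a j)" by (intro prod_ennreal) auto
    also have "\<dots> \<le> ennreal (\<Sum>j\<in>P. a j * r j)"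
      using P r \<open>sum a P = 1\<close> by (intro ennreal_leI weighted_AM_GM_real) (auto intro: less_imp_le)
    also have "\<dots> = (\<Sum>j\<in>P. ennreal (a j * r j))"
      using P r by (intro sum_ennreal[symmetric]) (auto intro!: mult_nonneg_nonneg less_imp_le)
    also have "\<dots> = (\<Sum>j\<in>P. ennreal (a j) * x j)"
      using P r by (intro sum.cong) (auto simp: ennreal_mult'' less_imp_le)
    finally show ?thesis by (simp add: L R)
  qed
qed

text \<open>Hoelder's inequality for finitely many functions. If all integrals are positive and finite,
divide each function by its integral: the weighted arithmetic-geometric inequality then bounds
the product pointwise by a convex combination of functions of integral 1. If an integral
vanishes, so does the product almost everywhere; otherwise an infinite integral makes the
right-hand side infinite.\<close>
lemma nn_integral_Holder:
  fixes a :: "'j \<Rightarrow> real" and f :: "'j \<Rightarrow> 'a \<Rightarrow> ennreal"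
  assumes fin: "finite J" and a0: "\<And>j. j \<in> J \<Longrightarrow> 0 \<le> a j" and a1: "sum a J = 1"
    and [measurable]: "\<And>j. j \<in> J \<Longrightarrow> f j \<in> borel_measurable M"
  shows "(\<integral>\<^sup>+x. (\<Prod>j\<in>J. epow (f j x) (a j)) \<partial>M) \<le> (\<Prod>j\<in>J. epow (\<integral>\<^sup>+x. f j x \<partial>M) (a j))"
proof -
  define P where "P = {j \<in> J. a j \<noteq> 0}"
  have P: "finite P" "P \<subseteq> J" "\<And>j. j \<in> P \<Longrightarrow> 0 < a j" using fin a0 by (auto simp: P_def less_le)
  have [measurable]: "f j \<in> borel_measurable M" if "j \<in> P" for j using that P by auto
  have aP: "sum a P = 1" unfolding a1[symmetric] using fin by (intro sum.mono_neutral_left) (auto simp: P_def)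
  have red: "(\<Prod>j\<in>J. epow (y j) (a j)) = (\<Prod>j\<in>P. epow (y j) (a j))" for y
    using fin by (intro prod.mono_neutral_right) (auto simp: P_def)
  define c where "c j = (\<integral>\<^sup>+x. f j x \<partial>M)" for j
  consider (zero) j where "j \<in> P" "c j = 0"
    | (top) j where "j \<in> P" "c j = \<infinity>" "\<And>j. j \<in> P \<Longrightarrow> c j \<noteq> 0"
    | (pos) "\<And>j. j \<in> P \<Longrightarrow> c j \<noteq> \<infinity> \<and> c j \<noteq> 0" by blast
  then have "(\<integral>\<^sup>+x. (\<Prod>j\<in>P. epow (f j x) (a j)) \<partial>M) \<le> (\<Prod>j\<in>P. epow (c j) (a j))"
  proof cases
    case zero
    then have "AE x in M. f j x = 0" unfolding c_def by (subst (asm) nn_integral_0_iff_AE) auto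
    then have "AE x in M. (\<Prod>j\<in>P. epow (f j x) (a j)) = 0"
      by eventually_elim (use zero P in \<open>auto intro!: prod_zero bexI[of _ j] simp: epow_eq_0\<close>)
    then have "(\<integral>\<^sup>+x. (\<Prod>j\<in>P. epow (f j x) (a j)) \<partial>M) = 0"
      by (subst nn_integral_0_iff_AE) auto
    then show ?thesis by simp
  next
    case top
    have "(\<Prod>j\<in>P. epow (c j) (a j)) = \<infinity>" unfolding infinity_ennreal_def
      by (subst ennreal_prod_eq_top) (use top P in \<open>force simp: epow_eq_0 epow_top dest: P(3)\<close>)
    then show ?thesis by simp
  next
    case pos
    define r where "r j = enn2real (c j)" for j
    have r: "c j = ennreal (r j)" "0 < r j" if "j \<in> P" for j
      using pos[OF that] by (auto simp: r_def enn2real_positive_iff less_top[symmetric] zero_less_iff_neq_zero)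
    have split: "epow (f j x) (a j) = epow (c j) (a j) * epow (f j x / c j) (a j)" if "j \<in> P" for j x
      using r[OF that] P(3)[OF that]
      by (cases "f j x") (auto simp: epow_ennreal epow_top divide_ennreal ennreal_mult[symmetric]
          powr_divide ennreal_top_divide ennreal_mult_top)
    have "(\<integral>\<^sup>+x. (\<Prod>j\<in>P. epow (f j x) (a j)) \<partial>M)
        = (\<integral>\<^sup>+x. (\<Prod>j\<in>P. epow (c j) (a j)) * (\<Prod>j\<in>P. epow (f j x / c j) (a j)) \<partial>M)"
      by (simp add: split prod.distrib)
    also have "\<dots> = (\<Prod>j\<in>P. epow (c j) (a j)) * (\<integral>\<^sup>+x. (\<Prod>j\<in>P. epow (f j x / c j) (a j)) \<partial>M)"
      by (intro nn_integral_cmult) auto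
    also have "(\<integral>\<^sup>+x. (\<Prod>j\<in>P. epow (f j x / c j) (a j)) \<partial>M) \<le> (\<integral>\<^sup>+x. (\<Sum>j\<in>P. ennreal (a j) * (f j x / c j)) \<partial>M)"
      using P aP by (intro nn_integral_mono weighted_AM_GM) (auto intro: less_imp_le)
    also have "\<dots> = (\<Sum>j\<in>P. ennreal (a j) * (c j / c j))"
      unfolding c_def by (subst nn_integral_sum) (auto simp: nn_integral_cmult nn_integral_divide)
    also have "\<dots> = (\<Sum>j\<in>P. ennreal (a j))"
      using pos by (intro sum.cong) (auto simp: ennreal_divide_self less_top zero_less_iff_neq_zero)
    also have "\<dots> = 1" using P aP by (subst sum_ennreal) (auto intro: less_imp_le)
    finally show ?thesis by (simp add: mult_left_mono)
  qed
  then show ?thesis by (simp add: red c_def)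
qed

section \<open>Integrals along coordinate lines\<close>

lemma (in product_sigma_finite) line_integral_measurable:
  assumes [measurable]: "f \<in> borel_measurable (Pi\<^sub>M (insert i I) M)"
  shows "(\<lambda>x. \<integral>\<^sup>+t. f (x(i := t)) \<partial>M i) \<in> borel_measurable (Pi\<^sub>M I M)"
proof -
  have "(\<lambda>(x, t). f (x(i := t))) \<in> borel_measurable (Pi\<^sub>M I M \<Otimes>\<^sub>M M i)"
    by measurable
  from sigma_finite_measure.borel_measurable_nn_integral_fst[OF sigma_finite_measures this] show ?thesis by simp
qed

text \<open>The combinatorial core of the Gagliardo--Nirenberg inequality, an estimate of the Loomis--Whitney
type. It is the case \<open>a = 1 / (card I - 1)\<close> that is used, where the power of \<open>f x\<close> is trivial and
the left-hand side is the integral of a product of integrals of \<open>f\<close> along the lines parallel to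
the axes. The general power of \<open>f x\<close> is there for an induction on the set of coordinates:
integrating out the coordinate \<open>i\<close>, the line integral in direction \<open>i\<close> is constant, and the
exponents of the remaining factors add up to 1. Hoelder's inequality and Fubini's theorem
therefore replace \<open>f\<close> by its integral \<open>F\<close> over that coordinate, and the result is the same
expression for \<open>F\<close> on the smaller set of coordinates.\<close>
lemma (in product_sigma_finite) grid_lines:
  fixes f :: "('i \<Rightarrow> 'a) \<Rightarrow> ennreal"
  assumes "finite I" "0 \<le> a" "(real (card I) - 1) * a \<le> 1"
    and "f \<in> borel_measurable (Pi\<^sub>M I M)"
  shows "(\<integral>\<^sup>+x. epow (f x) (1 - (real (card I) - 1) * a) *
            (\<Prod>i\<in>I. epow (\<integral>\<^sup>+t. f (x(i := t)) \<partial>M i) a) \<partial>Pi\<^sub>M I M)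
         \<le> epow (\<integral>\<^sup>+x. f x \<partial>Pi\<^sub>M I M) (1 + a)"
  using assms(1,3,4)
proof (induction I arbitrary: f rule: finite_induct)
  case empty
  then show ?case by (simp add: nn_integral_empty)
next
  case (insert i I)
  note [measurable] = insert.prems(2)
  let ?k = "real (card I)"
  have k: "?k * a \<le> 1" "(?k - 1) * a \<le> 1"
    using insert.prems(1) insert.hyps \<open>0 \<le> a\<close> by (auto simp: algebra_simps)
  define F where "F x = (\<integral>\<^sup>+t. f (x(i := t)) \<partial>M i)" for x
  have F [measurable]: "F \<in> borel_measurable (Pi\<^sub>M I M)"
    unfolding F_def by (rule line_integral_measurable) fact
  have L [measurable]: "(\<lambda>x. \<integral>\<^sup>+t. f (x(j := t)) \<partial>M j) \<in> borel_measurable (Pi\<^sub>M (insert i I) M)"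
    if "j \<in> insert i I" for j
    by (rule line_integral_measurable) (use that insert.prems in \<open>simp add: insert_absorb\<close>)
  have inner: "(\<integral>\<^sup>+y. epow (f (x(i := y))) (1 - ?k * a) *
         (\<Prod>j\<in>insert i I. epow (\<integral>\<^sup>+t. f ((x(i := y))(j := t)) \<partial>M j) a) \<partial>M i)
      \<le> epow (F x) (1 - (?k - 1) * a) * (\<Prod>j\<in>I. epow (\<integral>\<^sup>+t. F (x(j := t)) \<partial>M j) a)"
    if x: "x \<in> space (Pi\<^sub>M I M)" for x
  proof -
    have up [measurable]: "(\<lambda>y. x(i := y)) \<in> M i \<rightarrow>\<^sub>M Pi\<^sub>M (insert i I) M"
      using x insert.hyps by (intro measurable_component_update)
    \<comment> \<open>The index i is used for the pure power of f, which needs its own exponent.\<close>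
    define g where "g j y = (if j = i then f (x(i := y)) else \<integral>\<^sup>+t. f ((x(i := y))(j := t)) \<partial>M j)" for j y
    define b where "b j = (if j = i then 1 - ?k * a else a)" for j
    have gm: "g j \<in> borel_measurable (M i)" if "j \<in> insert i I" for j
    proof (cases "j = i")
      case False
      have "(\<lambda>y. \<integral>\<^sup>+t. f ((x(i := y))(j := t)) \<partial>M j) \<in> borel_measurable (M i)"
        using measurable_compose[OF up L[OF that]] .
      with False show ?thesis by (simp add: g_def[abs_def])
    qed (simp add: g_def[abs_def])
    have "sum b I = (\<Sum>j\<in>I. a)"
      using insert.hyps by (intro sum.cong) (auto simp: b_def)
    then have "sum b (insert i I) = 1 - ?k * a + (\<Sum>j\<in>I. a)"
      using insert.hyps by (simp add: b_def)
    then have b1: "sum b (insert i I) = 1" by simp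
    have swap: "(\<integral>\<^sup>+y. g j y \<partial>M i) = (\<integral>\<^sup>+t. F (x(j := t)) \<partial>M j)" if j: "j \<in> I" for j
    proof -
      have ji: "j \<noteq> i" using insert.hyps j by auto
      interpret ij: pair_sigma_finite "M i" "M j"
        by (intro pair_sigma_finite.intro sigma_finite_measures)
      have "(\<lambda>(y, t). (x(i := y))(j := t)) \<in> M i \<Otimes>\<^sub>M M j \<rightarrow>\<^sub>M Pi\<^sub>M (insert i I) M"
      proof -
        have "(\<lambda>z. (x(i := fst z))(j := snd z)) \<in> M i \<Otimes>\<^sub>M M j \<rightarrow>\<^sub>M Pi\<^sub>M (insert i I) M"
          by (rule measurable_fun_upd[where J="insert i I"]) (use j in auto)
        then show ?thesis by (simp add: case_prod_unfold)
      qed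
      then have "(\<lambda>(y, t). f ((x(i := y))(j := t))) \<in> borel_measurable (M i \<Otimes>\<^sub>M M j)"
        using measurable_compose[OF _ insert.prems(2)] by (simp add: case_prod_unfold)
      from ij.Fubini'[OF this] have "(\<integral>\<^sup>+y. \<integral>\<^sup>+t. f ((x(i := y))(j := t)) \<partial>M j \<partial>M i)
          = (\<integral>\<^sup>+t. \<integral>\<^sup>+y. f ((x(i := y))(j := t)) \<partial>M i \<partial>M j)" by simp
      then show ?thesis using ji by (simp add: g_def F_def fun_upd_twist)
    qed
    have "(\<integral>\<^sup>+y. epow (f (x(i := y))) (1 - ?k * a) *
         (\<Prod>j\<in>insert i I. epow (\<integral>\<^sup>+t. f ((x(i := y))(j := t)) \<partial>M j) a) \<partial>M i)
       = (\<integral>\<^sup>+y. epow (F x) a * (\<Prod>j\<in>insert i I. epow (g j y) (b j)) \<partial>M i)"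
    proof (intro nn_integral_cong)
      fix y
      have "(\<Prod>j\<in>I. epow (g j y) (b j)) = (\<Prod>j\<in>I. epow (\<integral>\<^sup>+t. f ((x(i := y))(j := t)) \<partial>M j) a)"
        using insert.hyps by (intro prod.cong) (auto simp: g_def b_def)
      then show "epow (f (x(i := y))) (1 - ?k * a) *
           (\<Prod>j\<in>insert i I. epow (\<integral>\<^sup>+t. f ((x(i := y))(j := t)) \<partial>M j) a)
         = epow (F x) a * (\<Prod>j\<in>insert i I. epow (g j y) (b j))"
        using insert.hyps by (simp add: F_def g_def b_def mult_ac)
    qed
    also have "\<dots> = epow (F x) a * (\<integral>\<^sup>+y. (\<Prod>j\<in>insert i I. epow (g j y) (b j)) \<partial>M i)"
      by (rule nn_integral_cmult, rule borel_measurable_prod_ennreal, rule epow_measurable, rule gm)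
    also have "\<dots> \<le> epow (F x) a * (\<Prod>j\<in>insert i I. epow (\<integral>\<^sup>+y. g j y \<partial>M i) (b j))"
      by (intro mult_left_mono nn_integral_Holder gm b1)
         (use insert.hyps k \<open>0 \<le> a\<close> in \<open>auto simp: b_def\<close>)
    also have "(\<Prod>j\<in>insert i I. epow (\<integral>\<^sup>+y. g j y \<partial>M i) (b j))
       = epow (F x) (1 - ?k * a) * (\<Prod>j\<in>I. epow (\<integral>\<^sup>+t. F (x(j := t)) \<partial>M j) a)"
    proof -
      have "(\<Prod>j\<in>I. epow (\<integral>\<^sup>+y. g j y \<partial>M i) (b j)) = (\<Prod>j\<in>I. epow (\<integral>\<^sup>+t. F (x(j := t)) \<partial>M j) a)"
        using insert.hyps by (intro prod.cong) (auto simp: swap b_def)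
      then show ?thesis using insert.hyps by (simp add: b_def g_def F_def)
    qed
    also have "epow (F x) a * \<dots> = epow (F x) (1 - (?k - 1) * a) * (\<Prod>j\<in>I. epow (\<integral>\<^sup>+t. F (x(j := t)) \<partial>M j) a)"
    proof -
      have "epow (F x) (1 - (?k - 1) * a) = epow (F x) (a + (1 - ?k * a))"
        by (simp add: algebra_simps)
      also have "\<dots> = epow (F x) a * epow (F x) (1 - ?k * a)"
        using k \<open>0 \<le> a\<close> by (intro epow_add) auto
      finally show ?thesis by (simp add: mult_ac)
    qed
    finally show ?thesis .
  qed
  have "(\<integral>\<^sup>+x. epow (f x) (1 - (real (card (insert i I)) - 1) * a) *
            (\<Prod>j\<in>insert i I. epow (\<integral>\<^sup>+t. f (x(j := t)) \<partial>M j) a) \<partial>Pi\<^sub>M (insert i I) M)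
      = (\<integral>\<^sup>+x. epow (f x) (1 - ?k * a) *
            (\<Prod>j\<in>insert i I. epow (\<integral>\<^sup>+t. f (x(j := t)) \<partial>M j) a) \<partial>Pi\<^sub>M (insert i I) M)"
    using insert.hyps by simp
  also have "\<dots> = (\<integral>\<^sup>+x. \<integral>\<^sup>+y. epow (f (x(i := y))) (1 - ?k * a) *
         (\<Prod>j\<in>insert i I. epow (\<integral>\<^sup>+t. f ((x(i := y))(j := t)) \<partial>M j) a) \<partial>M i \<partial>Pi\<^sub>M I M)"
    by (intro product_nn_integral_insert insert.hyps borel_measurable_times_ennreal borel_measurable_prod_ennreal
          epow_measurable L insert.prems)
  also have "\<dots> \<le> (\<integral>\<^sup>+x. epow (F x) (1 - (?k - 1) * a) *
      (\<Prod>j\<in>I. epow (\<integral>\<^sup>+t. F (x(j := t)) \<partial>M j) a) \<partial>Pi\<^sub>M I M)"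
    by (intro nn_integral_mono inner)
  also have "\<dots> \<le> epow (\<integral>\<^sup>+x. F x \<partial>Pi\<^sub>M I M) (1 + a)"
    by (rule insert.IH) (use k F in auto)
  also have "(\<integral>\<^sup>+x. F x \<partial>Pi\<^sub>M I M) = (\<integral>\<^sup>+x. f x \<partial>Pi\<^sub>M (insert i I) M)"
    unfolding F_def by (rule product_nn_integral_insert[symmetric]) (use insert in auto)
  finally show ?case .
qed

section \<open>The Gagliardo--Nirenberg inequality for test functions\<close>

lemma has_real_derivative_abs_powr:
  fixes y g :: real
  assumes "1 < g"
  shows "((\<lambda>y. \<bar>y\<bar> powr g) has_real_derivative g * (\<bar>y\<bar> powr (g - 1)) * sgn y) (at y)"
proof (cases "y = 0")
  case False
  consider "0 < y" | "y < 0" using False by linarith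
  then show ?thesis
  proof cases
    case 1
    have "((\<lambda>y. y powr g) has_real_derivative g * y powr (g - 1)) (at y)"
      using 1 by (auto intro!: derivative_eq_intros)
    then show ?thesis
      using 1
      by (auto intro: has_field_derivative_transform_within_open[where S="{0<..}"])
  next
    case 2
    have "((\<lambda>y. (- y) powr g) has_real_derivative - (g * (- y) powr (g - 1))) (at y)"
      using 2 by (auto intro!: derivative_eq_intros)
    then show ?thesis
      using 2
      by (auto intro: has_field_derivative_transform_within_open[where S="{..<0}"])
  qed
next
  case True
  have "((\<lambda>h. \<bar>h\<bar> powr (g - 1)) \<longlongrightarrow> 0) (at (0::real))"
  proof -
    have "((\<lambda>h. \<bar>h\<bar> powr (g - 1)) \<longlongrightarrow> \<bar>0\<bar> powr (g - 1)) (at (0::real))"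
      using assms by (intro tendsto_powr') (auto intro!: tendsto_rabs_zero tendsto_ident_at always_eventually)
    then show ?thesis by simp
  qed
  then have "((\<lambda>h. \<bar>h\<bar> powr g / h) \<longlongrightarrow> 0) (at (0::real))"
    by (rule Lim_transform_bound[rotated]) (auto simp: eventually_at_filter powr_diff abs_mult intro!: always_eventually)
  then show ?thesis using True by (simp add: DERIV_def)
qed

text \<open>The fundamental theorem of calculus for \<open>\<bar>h\<bar> powr g\<close>, starting from a zero of \<open>h\<close>. Since
\<open>g > 1\<close>, this power is differentiable also where \<open>h\<close> vanishes.\<close>
lemma abs_powr_le_line_integral:
  fixes h h' :: "real \<Rightarrow> real"
  assumes d: "\<And>t. (h has_real_derivative h' t) (at t)" and c: "continuous_on UNIV h'"
    and "h a = 0" "a \<le> x" "1 < g"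
  shows "ennreal (\<bar>h x\<bar> powr g) \<le> (\<integral>\<^sup>+t. ennreal (g * \<bar>h t\<bar> powr (g - 1) * \<bar>h' t\<bar>) \<partial>lborel)"
proof -
  define G where "G t = g * \<bar>h t\<bar> powr (g - 1) * \<bar>h' t\<bar>" for t
  define D where "D t = g * (\<bar>h t\<bar> powr (g - 1)) * sgn (h t) * h' t" for t
  have "continuous_on UNIV h" using d by (auto intro!: DERIV_continuous_on)
  then have "continuous_on UNIV G" unfolding G_def
    using c \<open>1 < g\<close> by (intro continuous_intros continuous_on_powr') auto
  then have Gint: "G integrable_on {a..x}"
    by (intro integrable_continuous_interval) (auto intro: continuous_on_subset)
  have "((\<lambda>t. \<bar>h t\<bar> powr g) has_real_derivative D t) (at t)" for t
    unfolding D_def by (rule DERIV_chain2[OF has_real_derivative_abs_powr[OF \<open>1 < g\<close>] d])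
  then have "(D has_integral (\<bar>h x\<bar> powr g - \<bar>h a\<bar> powr g)) {a..x}"
    using \<open>a \<le> x\<close> by (intro fundamental_theorem_of_calculus)
       (auto simp: has_real_derivative_iff_has_vector_derivative[symmetric] has_field_derivative_at_within)
  then have D: "(D has_integral (\<bar>h x\<bar> powr g)) {a..x}" using \<open>h a = 0\<close> by simp
  have "\<bar>h x\<bar> powr g = norm (integral {a..x} D)" using D by (simp add: integral_unique)
  also have "\<dots> \<le> integral {a..x} G"
    using D \<open>1 < g\<close> by (intro integral_norm_bound_integral Gint)
      (auto simp: D_def G_def abs_mult abs_sgn_eq)
  finally have "ennreal (\<bar>h x\<bar> powr g) \<le> ennreal (integral {a..x} G)" by (rule ennreal_leI)
  also have "\<dots> = (\<integral>\<^sup>+t. indicator {a..x} t * ennreal (G t) \<partial>lborel)"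
  proof -
    have "0 \<le> G t" for t using \<open>1 < g\<close> by (simp add: G_def)
    then have "(\<integral>\<^sup>+t. ennreal (indicator {a..x} t * G t) \<partial>lborel) = ennreal (integral {a..x} G)"
      using Gint by (intro nn_integral_has_integral_lebesgue) (auto simp: integrable_integral)
    then show ?thesis using \<open>\<And>t. 0 \<le> G t\<close> by (simp add: ennreal_mult ennreal_indicator)
  qed
  also have "\<dots> \<le> (\<integral>\<^sup>+t. ennreal (G t) \<partial>lborel)"
    by (intro nn_integral_mono) (auto split: split_indicator)
  finally show ?thesis by (simp add: G_def)
qed

lemma test_function_differentiable: "\<phi> \<in> test_functions \<Longrightarrow> \<phi> differentiable at x"
  unfolding test_functions_def by (auto dest!: spec[of _ "Suc 0"])

lemma test_function_continuous: "\<phi> \<in> test_functions \<Longrightarrow> continuous_on UNIV \<phi>"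
  unfolding test_functions_def by (auto dest!: spec[of _ 0])

lemma test_function_grad_continuous:
  fixes \<phi> :: "real ^ 'n \<Rightarrow> real"
  assumes "\<phi> \<in> test_functions"
  shows "continuous_on UNIV (grad \<phi>)"
proof -
  have "continuous_on UNIV (\<lambda>x. grad \<phi> x $ i)" for i
    using assms unfolding test_functions_def by (auto dest!: spec[of _ "Suc 0"])
  then have "continuous_on UNIV (\<lambda>x. \<chi> i. grad \<phi> x $ i)" by (intro continuous_on_vec_lambda)
  then show ?thesis by simp
qed

lemma test_function_bounded_support:
  fixes \<phi> :: "real ^ 'n \<Rightarrow> real"
  assumes "\<phi> \<in> test_functions"
  obtains R where "0 < R" "\<And>x. R \<le> norm x \<Longrightarrow> \<phi> x = 0"
proof -
  have "bounded (closure {x. \<phi> x \<noteq> 0})"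
    using assms by (auto simp: test_functions_def compact_imp_bounded)
  then have "bounded {x. \<phi> x \<noteq> 0}" by (rule bounded_subset) (rule closure_subset)
  then obtain B where B: "\<And>x. \<phi> x \<noteq> 0 \<Longrightarrow> norm x \<le> B" by (auto simp: bounded_iff)
  show thesis
    by (rule that[of "max 1 (B + 1)"]) (use B in force)+
qed

lemma test_function_directional_derivative:
  fixes \<phi> :: "real ^ 'n \<Rightarrow> real"
  assumes "\<phi> \<in> test_functions"
  shows "((\<lambda>t. \<phi> (y + t *\<^sub>R axis i 1)) has_real_derivative grad \<phi> (y + t *\<^sub>R axis i 1) $ i) (at t)"
proof -
  let ?D = "frechet_derivative \<phi> (at (y + t *\<^sub>R axis i 1))"
  have D: "(\<phi> has_derivative ?D) (at (y + t *\<^sub>R axis i 1))"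
    using test_function_differentiable[OF assms] by (simp add: frechet_derivative_works)
  have "((\<lambda>t. y + t *\<^sub>R axis i 1) has_derivative (\<lambda>s. s *\<^sub>R axis i 1)) (at t)"
    by (auto intro!: derivative_eq_intros)
  from has_derivative_compose[OF this D]
  have "((\<lambda>t. \<phi> (y + t *\<^sub>R axis i 1)) has_derivative (\<lambda>s. ?D (s *\<^sub>R axis i 1))) (at t)" .
  moreover have "?D (s *\<^sub>R axis i 1) = (grad \<phi> (y + t *\<^sub>R axis i 1) $ i) * s" for s
    using linear_cmul[OF has_derivative_linear[OF D], of s "axis i 1"] by (simp add: grad_def mult.commute)
  ultimately show ?thesis by (simp add: has_field_derivative_def)
qed

lemma test_function_powr_le_line_integral:
  fixes \<phi> :: "real ^ 'n \<Rightarrow> real"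
  assumes "\<phi> \<in> test_functions" "1 < g"
  shows "ennreal (\<bar>\<phi> (y + s *\<^sub>R axis i 1)\<bar> powr g)
    \<le> (\<integral>\<^sup>+t. ennreal (g * \<bar>\<phi> (y + t *\<^sub>R axis i 1)\<bar> powr (g - 1) * norm (grad \<phi> (y + t *\<^sub>R axis i 1))) \<partial>lborel)"
proof -
  obtain R where R: "0 < R" "\<And>x. R \<le> norm x \<Longrightarrow> \<phi> x = 0"
    using test_function_bounded_support[OF assms(1)] by blast
  define a where "a = min s (- (R + norm y))"
  have "norm (a *\<^sub>R axis i (1::real) :: real ^ 'n) = \<bar>a\<bar>" by (simp add: norm_axis_1)
  then have "R \<le> norm (y + a *\<^sub>R axis i 1)"
    using norm_triangle_ineq4[of "y + a *\<^sub>R axis i 1" y] R(1) unfolding a_def by auto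
  then have a: "\<phi> (y + a *\<^sub>R axis i 1) = 0" by (rule R)
  have "ennreal (\<bar>\<phi> (y + s *\<^sub>R axis i 1)\<bar> powr g)
    \<le> (\<integral>\<^sup>+t. ennreal (g * \<bar>\<phi> (y + t *\<^sub>R axis i 1)\<bar> powr (g - 1) * \<bar>grad \<phi> (y + t *\<^sub>R axis i 1) $ i\<bar>) \<partial>lborel)"
  proof (rule abs_powr_le_line_integral[OF test_function_directional_derivative[OF assms(1)] _ a _ assms(2)])
    show "continuous_on UNIV (\<lambda>t. grad \<phi> (y + t *\<^sub>R axis i 1) $ i)"
      by (intro continuous_intros continuous_on_compose2[OF test_function_grad_continuous[OF assms(1)]]) auto
  qed (simp add: a_def)
  also have "\<dots> \<le> (\<integral>\<^sup>+t. ennreal (g * \<bar>\<phi> (y + t *\<^sub>R axis i 1)\<bar> powr (g - 1) * norm (grad \<phi> (y + t *\<^sub>R axis i 1))) \<partial>lborel)"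
    using \<open>1 < g\<close> by (intro nn_integral_mono ennreal_leI mult_left_mono component_le_norm_cart) auto
  finally show ?thesis .
qed

text \<open>The Gagliardo--Nirenberg inequality (the Sobolev inequality for exponent 1) applied to the
function \<open>\<bar>\<phi>\<bar> powr g\<close>. Its value at a point is at most the integral of the norm of its gradient
along each of the \<open>n\<close> coordinate lines through that point; the product of these bounds, each raised
to the power \<open>1 / (n - 1)\<close>, is the integrand of \<open>grid_lines\<close>.\<close>
lemma Gagliardo_Nirenberg_powr:
  fixes \<phi> :: "real ^ 'n \<Rightarrow> real"
  assumes \<phi>: "\<phi> \<in> test_functions" and "1 < g" and n: "2 \<le> CARD('n)"
  defines "m \<equiv> real CARD('n) / (real CARD('n) - 1)"
  shows "(\<integral>\<^sup>+x. ennreal (\<bar>\<phi> x\<bar> powr (g * m)) \<partial>lborel)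
    \<le> epow (\<integral>\<^sup>+x. ennreal (g * \<bar>\<phi> x\<bar> powr (g - 1) * norm (grad \<phi> x)) \<partial>lborel) m"
proof -
  let ?B = "Basis :: (real ^ 'n) set"
  let ?P = "\<Pi>\<^sub>M b\<in>?B. (lborel :: real measure)"
  interpret product_sigma_finite "\<lambda>b :: real ^ 'n. lborel :: real measure" ..
  \<comment> \<open>Lebesgue measure is the image of the product measure under E, which assembles a
    point from its coordinates.\<close>
  define E where "E x = (\<Sum>b\<in>?B. x b *\<^sub>R b)" for x :: "real ^ 'n \<Rightarrow> real"
  define f where "f x = ennreal (g * \<bar>\<phi> x\<bar> powr (g - 1) * norm (grad \<phi> x))" for x
  define a where "a = 1 / (real CARD('n) - 1)"
  have am: "1 + a = m" "(real CARD('n) - 1) * a = 1" "0 < a" "0 < m"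
    using n by (auto simp: a_def m_def field_simps)
  note [measurable] = borel_measurable_continuous_onI[OF test_function_continuous[OF \<phi>]]
    borel_measurable_continuous_onI[OF test_function_grad_continuous[OF \<phi>]]
  have f [measurable]: "f \<in> borel_measurable borel" unfolding f_def by measurable
  have E [measurable]: "E \<in> ?P \<rightarrow>\<^sub>M borel" unfolding E_def by measurable
  have tr: "(\<integral>\<^sup>+x. k x \<partial>lborel) = (\<integral>\<^sup>+x. k (E x) \<partial>?P)" if [measurable]: "k \<in> borel_measurable borel" for k
  proof -
    have "(\<integral>\<^sup>+x. k x \<partial>lborel) = (\<integral>\<^sup>+x. k x \<partial>distr ?P borel E)"
      unfolding E_def by (subst lborel_eq) (rule refl)
    also have "\<dots> = (\<integral>\<^sup>+x. k (E x) \<partial>?P)" by (rule nn_integral_distr) measurable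
    finally show ?thesis .
  qed
  have line: "ennreal (\<bar>\<phi> (E x)\<bar> powr g) \<le> (\<integral>\<^sup>+t. f (E (x(b := t))) \<partial>lborel)" if b: "b \<in> ?B" for x b
  proof -
    obtain i where i: "b = axis i 1" using b by (auto simp: Basis_vec_def)
    define y where "y = E (x(b := 0))"
    have upd: "E (x(b := t)) = y + t *\<^sub>R b" for t
    proof -
      have "E (x(b := t)) = (\<Sum>c\<in>?B. (x(b := 0)) c *\<^sub>R c + (if c = b then t *\<^sub>R b else 0))"
        unfolding E_def by (intro sum.cong) auto
      then show ?thesis using b by (simp add: sum.distrib E_def y_def)
    qed
    have "E x = y + x b *\<^sub>R b" using upd[of "x b"] by simp
    then show ?thesis
      using test_function_powr_le_line_integral[OF \<phi> \<open>1 < g\<close>, of y "x b" i]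
      by (simp add: f_def i upd[unfolded i])
  qed
  have "(\<integral>\<^sup>+x. ennreal (\<bar>\<phi> x\<bar> powr (g * m)) \<partial>lborel) = (\<integral>\<^sup>+x. ennreal (\<bar>\<phi> (E x)\<bar> powr (g * m)) \<partial>?P)"
    by (rule tr) measurable
  also have "\<dots> \<le> (\<integral>\<^sup>+x. epow (f (E x)) (1 - (real (card ?B) - 1) * a) *
        (\<Prod>b\<in>?B. epow (\<integral>\<^sup>+t. f (E (x(b := t))) \<partial>lborel) a) \<partial>?P)"
  proof (intro nn_integral_mono)
    fix x
    have "ennreal (\<bar>\<phi> (E x)\<bar> powr (g * m)) = (\<Prod>b\<in>?B. epow (ennreal (\<bar>\<phi> (E x)\<bar> powr g)) a)"
    proof -
      let ?r = "\<bar>\<phi> (E x)\<bar> powr g"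
      have "(?r powr a) ^ CARD('n) = ?r powr m"
      proof (cases "?r = 0")
        case True
        show ?thesis unfolding True using n by simp
      next
        case False
        have "real CARD('n) * a = m" using am by (simp add: algebra_simps)
        then show ?thesis using powr_power[OF False, of a "CARD('n)"] by simp
      qed
      then show ?thesis
        using am by (simp add: epow_ennreal ennreal_power powr_powr)
    qed
    also have "\<dots> \<le> (\<Prod>b\<in>?B. epow (\<integral>\<^sup>+t. f (E (x(b := t))) \<partial>lborel) a)"
      using am by (intro prod_mono_ennreal epow_mono line) auto
    finally show "ennreal (\<bar>\<phi> (E x)\<bar> powr (g * m)) \<le> epow (f (E x)) (1 - (real (card ?B) - 1) * a) *
        (\<Prod>b\<in>?B. epow (\<integral>\<^sup>+t. f (E (x(b := t))) \<partial>lborel) a)"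
      using am by simp
  qed
  also have "\<dots> \<le> epow (\<integral>\<^sup>+x. f (E x) \<partial>?P) (1 + a)"
    using am by (intro grid_lines) auto
  also have "\<dots> = epow (\<integral>\<^sup>+x. f x \<partial>lborel) m" by (simp add: tr am)
  finally show ?thesis by (simp add: f_def)
qed

section \<open>The Sobolev inequality\<close>

lemma epow_cmult:
  assumes "0 < c" "0 < a"
  shows "epow (ennreal c * x) a = ennreal (c powr a) * epow x a"
  using assms by (cases x) (auto simp: ennreal_mult_top epow_top epow_ennreal ennreal_mult'[symmetric] powr_mult)

lemma power_integral_finite:
  fixes f :: "real ^ 'n \<Rightarrow> 'b::real_normed_vector"
  assumes "continuous_on UNIV f" and R: "\<And>x. R < norm x \<Longrightarrow> f x = 0" and "0 < q"
  shows "(\<integral>\<^sup>+x. ennreal (norm (f x) powr q) \<partial>lborel) < \<infinity>"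
proof -
  have "compact (f ` cball 0 R)"
    by (intro compact_continuous_image continuous_on_subset[OF assms(1)]) auto
  then have "bounded (f ` cball 0 R)" by (rule compact_imp_bounded)
  then obtain C where C: "\<forall>x\<in>cball 0 R. norm (f x) \<le> C"
    unfolding bounded_iff by blast
  have "ennreal (norm (f x) powr q) \<le> ennreal (C powr q) * indicator (cball 0 R) x" for x
    using R[of x] C[rule_format, of x] \<open>0 < q\<close>
    by (cases "x \<in> cball 0 R") (auto intro!: ennreal_leI powr_mono2)
  then have "(\<integral>\<^sup>+x. ennreal (norm (f x) powr q) \<partial>lborel) \<le> (\<integral>\<^sup>+x. ennreal (C powr q) * indicator (cball (0 :: real ^ 'n) R) x \<partial>lborel)"
    by (intro nn_integral_mono)
  also have "\<dots> = ennreal (C powr q) * emeasure lborel (cball (0 :: real ^ 'n) R)"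
    by (simp add: nn_integral_cmult_indicator)
  also have "\<dots> < \<infinity>"
    using emeasure_bounded_finite[of "cball (0 :: real ^ 'n) R"] by (simp add: ennreal_mult_less_top)
  finally show ?thesis .
qed

lemma test_function_power_integral_finite:
  fixes \<phi> :: "real ^ 'n \<Rightarrow> real"
  assumes \<phi>: "\<phi> \<in> test_functions" and "0 < q"
  shows "(\<integral>\<^sup>+x. ennreal (\<bar>\<phi> x\<bar> powr q) \<partial>lborel) < \<infinity>"
    and "(\<integral>\<^sup>+x. ennreal (norm (grad \<phi> x) powr q) \<partial>lborel) < \<infinity>"
proof -
  obtain R where R: "0 < R" "\<And>x. R \<le> norm x \<Longrightarrow> \<phi> x = 0"
    using test_function_bounded_support[OF \<phi>] by blast
  show "(\<integral>\<^sup>+x. ennreal (\<bar>\<phi> x\<bar> powr q) \<partial>lborel) < \<infinity>"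
    using power_integral_finite[OF test_function_continuous[OF \<phi>] _ \<open>0 < q\<close>, of R] R by simp
  have "grad \<phi> x = 0" if x: "R < norm x" for x
  proof -
    have "open {y :: real ^ 'n. R < norm y}" by (intro open_Collect_less continuous_intros)
    then have "(\<phi> has_derivative (\<lambda>_. 0)) (at x)"
      using has_derivative_transform_within_open[of "\<lambda>_. 0" "\<lambda>_. 0" x UNIV "{y. R < norm y}" \<phi>] x R(2)
      by (simp add: less_imp_le)
    then have "frechet_derivative \<phi> (at x) = (\<lambda>_. 0)"
      by (rule frechet_derivative_at[symmetric])
    then show ?thesis by (simp add: grad_def vec_eq_iff)
  qed
  then show "(\<integral>\<^sup>+x. ennreal (norm (grad \<phi> x) powr q) \<partial>lborel) < \<infinity>"
    using power_integral_finite[OF test_function_grad_continuous[OF \<phi>] _ \<open>0 < q\<close>] by blast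
qed

text \<open>The exponent \<open>g\<close> is chosen so that \<open>\<bar>\<phi>\<bar> powr (g - 1)\<close> raised to the exponent conjugate to \<open>p\<close>
is again \<open>\<bar>\<phi>\<bar> powr q\<close>. Hoelder's inequality then bounds the right-hand side of
\<open>Gagliardo_Nirenberg_powr\<close> by a power less than 1 of the integral on the left-hand side, times
a power of the integral of \<open>norm (grad \<phi>) powr p\<close>; the former power can be absorbed because the integral is finite.\<close>
lemma Sobolev_test_function:
  fixes \<phi> :: "real ^ 'n \<Rightarrow> real" and p :: real
  assumes \<phi>: "\<phi> \<in> test_functions" and p: "1 < p" "p < real CARD('n)"
  defines "q \<equiv> sobolev_exponent CARD('n) p" and "g \<equiv> p * (real CARD('n) - 1) / (real CARD('n) - p)"
  shows "(\<integral>\<^sup>+x. ennreal (\<bar>\<phi> x\<bar> powr q) \<partial>lborel)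
    \<le> ennreal (g powr q) * epow (\<integral>\<^sup>+x. ennreal (norm (grad \<phi> x) powr p) \<partial>lborel) (q / p)"
proof -
  define n where "n = real CARD('n)"
  define m where "m = n / (n - 1)"
  have n: "2 \<le> CARD('n)" "1 < p" "p < n" "1 < n" using p by (auto simp: n_def)
  have g: "1 < g" using n by (simp add: g_def n_def[symmetric] field_simps)
  have q: "0 < q" using n by (simp add: q_def sobolev_exponent_def n_def[symmetric])
  have m: "0 < m" using n by (simp add: m_def)
  have gm: "g * m = q" "(g - 1) = q * (1 - 1 / p)" "1 - m * (1 - 1 / p) = m / q"
    using n by (auto simp: g_def m_def q_def sobolev_exponent_def n_def[symmetric] divide_simps; algebra)+
  note [measurable] = borel_measurable_continuous_onI[OF test_function_continuous[OF \<phi>]]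
    borel_measurable_continuous_onI[OF test_function_grad_continuous[OF \<phi>]]
  define A where "A = (\<integral>\<^sup>+x. ennreal (\<bar>\<phi> x\<bar> powr q) \<partial>lborel)"
  define B where "B = (\<integral>\<^sup>+x. ennreal (norm (grad \<phi> x) powr p) \<partial>lborel)"
  \<comment> \<open>Hoelder with two factors, indexed by the Booleans.\<close>
  have "(\<integral>\<^sup>+x. ennreal (g * \<bar>\<phi> x\<bar> powr (g - 1) * norm (grad \<phi> x)) \<partial>lborel)
      = (\<integral>\<^sup>+x. ennreal g * (\<Prod>b\<in>(UNIV::bool set).
          epow (if b then ennreal (\<bar>\<phi> x\<bar> powr q) else ennreal (norm (grad \<phi> x) powr p))
              (if b then 1 - 1 / p else 1 / p)) \<partial>lborel)"
    using n g by (intro nn_integral_cong)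
       (simp add: UNIV_bool epow_ennreal powr_powr gm(2)[symmetric] ennreal_mult mult_ac)
  also have "\<dots> = ennreal g * (\<integral>\<^sup>+x. (\<Prod>b\<in>(UNIV::bool set).
          epow (if b then ennreal (\<bar>\<phi> x\<bar> powr q) else ennreal (norm (grad \<phi> x) powr p))
              (if b then 1 - 1 / p else 1 / p)) \<partial>lborel)"
    by (intro nn_integral_cmult) measurable
  also have "\<dots> \<le> ennreal g * (\<Prod>b\<in>(UNIV::bool set).
          epow (\<integral>\<^sup>+x. (if b then ennreal (\<bar>\<phi> x\<bar> powr q) else ennreal (norm (grad \<phi> x) powr p)) \<partial>lborel)
              (if b then 1 - 1 / p else 1 / p))"
    using n by (intro mult_left_mono nn_integral_Holder) (auto simp: UNIV_bool)
  also have "\<dots> = ennreal g * (epow A (1 - 1 / p) * epow B (1 / p))"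
    by (simp add: UNIV_bool A_def B_def mult_ac)
  finally have "epow (\<integral>\<^sup>+x. ennreal (g * \<bar>\<phi> x\<bar> powr (g - 1) * norm (grad \<phi> x)) \<partial>lborel) m
      \<le> epow (ennreal g * (epow A (1 - 1 / p) * epow B (1 / p))) m"
    using m by (intro epow_mono) auto
  with Gagliardo_Nirenberg_powr[OF \<phi> g n(1)]
  have main: "A \<le> epow (ennreal g * (epow A (1 - 1 / p) * epow B (1 / p))) m"
    unfolding A_def gm(1)[symmetric] m_def n_def by (rule order_trans)
  have "A < \<infinity>" unfolding A_def using \<phi> q by (rule test_function_power_integral_finite(1))
  then obtain \<alpha> where \<alpha>: "A = ennreal \<alpha>" "0 \<le> \<alpha>" by (cases A) auto
  have "A \<le> ennreal (g powr q) * epow B (q / p)"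
  proof (cases "\<alpha> = 0 \<or> B = top")
    case True
    then show ?thesis using \<alpha> g n q by (auto simp: epow_top ennreal_mult_top)
  next
    case False
    then obtain \<beta> where \<beta>: "B = ennreal \<beta>" "0 \<le> \<beta>" by (cases B) auto
    have "0 < \<alpha>" using False \<alpha> by auto
    have "ennreal \<alpha> \<le> ennreal ((g * (\<alpha> powr (1 - 1 / p) * \<beta> powr (1 / p))) powr m)"
      using main n g m \<beta> unfolding \<alpha>(1)
      by (simp add: epow_ennreal \<alpha>(2) ennreal_mult[symmetric])
    then have "\<alpha> \<le> (g * (\<alpha> powr (1 - 1 / p) * \<beta> powr (1 / p))) powr m"
      by simp
    also have "\<dots> = \<alpha> powr (m * (1 - 1 / p)) * (g * \<beta> powr (1 / p)) powr m"
      by (simp add: powr_mult powr_powr mult_ac)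
    finally have "\<alpha> / \<alpha> powr (m * (1 - 1 / p)) \<le> (g * \<beta> powr (1 / p)) powr m"
      using \<open>0 < \<alpha>\<close> by (simp add: divide_le_eq mult_ac)
    also have "\<alpha> / \<alpha> powr (m * (1 - 1 / p)) = \<alpha> powr (m / q)"
      using \<open>0 < \<alpha>\<close> by (simp add: gm(3)[symmetric] powr_diff)
    finally have "(\<alpha> powr (m / q)) powr (q / m) \<le> ((g * \<beta> powr (1 / p)) powr m) powr (q / m)"
      using q m by (intro powr_mono2) auto
    then have "\<alpha> \<le> g powr q * \<beta> powr (q / p)"
      using q m \<open>0 < \<alpha>\<close> by (simp add: powr_powr powr_mult)
    then have "ennreal \<alpha> \<le> ennreal (g powr q * \<beta> powr (q / p))" by (rule ennreal_leI)
    then show ?thesis using q n \<beta> by (simp add: \<alpha>(1) epow_ennreal ennreal_mult)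
  qed
  then show ?thesis by (simp add: A_def B_def)
qed

text \<open>A substitute for Minkowski's inequality that works directly with integrals of powers. It loses a
constant factor, which does no harm, since only the existence of a Sobolev constant matters.\<close>
lemma powr_norm_quasi_triangle:
  fixes x y :: "'a::real_normed_vector"
  assumes "0 < r"
  shows "norm x powr r \<le> 2 powr r * (norm (y - x) powr r + norm y powr r)"
proof -
  have "norm x \<le> 2 * max (norm (y - x)) (norm y)"
    using norm_triangle_ineq4[of y "y - x"] by auto
  then have "norm x powr r \<le> (2 * max (norm (y - x)) (norm y)) powr r"
    using assms by (intro powr_mono2) auto
  also have "\<dots> = 2 powr r * max (norm (y - x)) (norm y) powr r" by (simp add: powr_mult)
  also have "max (norm (y - x)) (norm y) powr r \<le> norm (y - x) powr r + norm y powr r"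
    by (auto simp: max_def)
  finally show ?thesis by simp
qed

lemma nn_integral_powr_quasi_triangle:
  fixes u v :: "'a \<Rightarrow> 'b::{real_normed_vector, second_countable_topology}"
  assumes "0 < r" and [measurable]: "u \<in> borel_measurable M" "v \<in> borel_measurable M"
  shows "(\<integral>\<^sup>+x. ennreal (norm (u x) powr r) \<partial>M) \<le> ennreal (2 powr r) *
    ((\<integral>\<^sup>+x. ennreal (norm (v x - u x) powr r) \<partial>M) + (\<integral>\<^sup>+x. ennreal (norm (v x) powr r) \<partial>M))"
proof -
  have "(\<integral>\<^sup>+x. ennreal (norm (u x) powr r) \<partial>M) \<le> (\<integral>\<^sup>+x. ennreal (2 powr r) *
    (ennreal (norm (v x - u x) powr r) + ennreal (norm (v x) powr r)) \<partial>M)"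
    using powr_norm_quasi_triangle[OF \<open>0 < r\<close>]
    by (intro nn_integral_mono) (simp add: ennreal_plus[symmetric] ennreal_mult[symmetric] del: ennreal_plus)
  also have "\<dots> = ennreal (2 powr r) * (\<integral>\<^sup>+x.
    (ennreal (norm (v x - u x) powr r) + ennreal (norm (v x) powr r)) \<partial>M)"
    by (intro nn_integral_cmult) measurable
  finally show ?thesis by (subst (asm) nn_integral_add) auto
qed

lemma eventually_power_integral_le:
  fixes F :: "nat \<Rightarrow> real ^ 'n \<Rightarrow> 'b::real_normed_vector"
  assumes "(\<lambda>k. Lp_norm r (F k)) \<longlonglongrightarrow> 0" "0 < r" "0 < e"
  shows "\<forall>\<^sub>F k in sequentially. (\<integral>\<^sup>+x. ennreal (norm (F k x) powr r) \<partial>lebesgue) \<le> ennreal e"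
proof -
  have "0 < ennreal (e powr (1 / r))" using assms by simp
  from order_tendstoD(2)[OF assms(1) this]
  show ?thesis
  proof eventually_elim
    case (elim k)
    let ?I = "\<integral>\<^sup>+x. ennreal (norm (F k x) powr r) \<partial>lebesgue"
    from elim have lt: "ennreal_powr ?I (1 / r) < ennreal (e powr (1 / r))" by (simp add: Lp_norm_def)
    show ?case
    proof (cases ?I)
      case (real i)
      with lt have "i powr (1 / r) < e powr (1 / r)" by (simp add: ennreal_powr_def ennreal_less_iff)
      moreover have "e powr (1 / r) \<le> i powr (1 / r)" if "e < i"
        using that assms by (intro powr_mono2) auto
      ultimately have "i \<le> e" by force
      then show ?thesis using real by (simp add: ennreal_leI)
    next
      case top
      with lt show ?thesis by (simp add: ennreal_powr_def)
    qed
  qed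
qed

text \<open>Passage from test functions to the completion: a test function that is close to \<open>u\<close>, and whose
gradient is close to \<open>G\<close>, satisfies the inequality, and the quasi-triangle inequality transfers
it to \<open>u\<close>. The term \<open>\<eta>\<close> measures the closeness. Keeping it in the statement covers vanishing
and nonvanishing gradients alike: it may be taken to be arbitrarily small in the first case and
equal to the integral of \<open>norm G powr p\<close> in the second.\<close>
lemma Sobolev_inequality:
  fixes p :: real
  assumes p: "1 < p" "p < real CARD('n::finite)"
  defines "q \<equiv> sobolev_exponent CARD('n) p"
  shows "\<exists>K>0. \<forall>(u :: real ^ 'n \<Rightarrow> real) G. \<forall>\<eta>>0. u \<in> borel_measurable lebesgue \<longrightarrow> has_gradient p u G \<longrightarrow>
    (\<integral>\<^sup>+x. ennreal (\<bar>u x\<bar> powr q) \<partial>lebesgue)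
      \<le> ennreal K * epow ((\<integral>\<^sup>+x. ennreal (norm (G x) powr p) \<partial>lebesgue) + ennreal \<eta>) (q / p)"
proof -
  define g where "g = p * (real CARD('n) - 1) / (real CARD('n) - p)"
  define K0 where "K0 = g powr q"
  define K where "K = 2 powr q * (1 + K0 * 2 powr q)"
  have q: "0 < q" using p by (simp add: q_def sobolev_exponent_def)
  have K: "0 \<le> K0" "0 < K" by (auto simp: K0_def K_def intro!: mult_pos_pos add_pos_nonneg)
  show ?thesis
  proof (intro exI[of _ K] conjI K allI impI)
    fix u :: "real ^ 'n \<Rightarrow> real" and G and \<eta> :: real
    assume "0 < \<eta>" and [measurable]: "u \<in> borel_measurable lebesgue" and grad: "has_gradient p u G"
    let ?I = "\<integral>\<^sup>+x. ennreal (norm (G x) powr p) \<partial>lebesgue"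
    let ?E = "epow (?I + ennreal \<eta>) (q / p)"
    from grad obtain \<phi> where \<phi>: "range \<phi> \<subseteq> test_functions"
      and grad_lim: "(\<lambda>k. Lp_norm p (\<lambda>x. grad (\<phi> k) x - G x)) \<longlonglongrightarrow> 0"
      and lim: "(\<lambda>k. Lp_norm q (\<lambda>x. \<phi> k x - u x)) \<longlonglongrightarrow> 0"
      and [measurable]: "G \<in> borel_measurable lebesgue"
      unfolding has_gradient_def q_def by blast
    \<comment> \<open>The two tolerances match the scaling of the inequality.\<close>
    have "\<forall>\<^sub>F k in sequentially.
        (\<integral>\<^sup>+x. ennreal (norm (grad (\<phi> k) x - G x) powr p) \<partial>lebesgue) \<le> ennreal \<eta> \<and>
        (\<integral>\<^sup>+x. ennreal (norm (\<phi> k x - u x) powr q) \<partial>lebesgue) \<le> ennreal (\<eta> powr (q / p))"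
      using \<open>0 < \<eta>\<close> p q
      by (intro eventually_conj eventually_power_integral_le[OF grad_lim] eventually_power_integral_le[OF lim]) auto
    then obtain k where k: "(\<integral>\<^sup>+x. ennreal (norm (grad (\<phi> k) x - G x) powr p) \<partial>lebesgue) \<le> ennreal \<eta>"
        "(\<integral>\<^sup>+x. ennreal (norm (\<phi> k x - u x) powr q) \<partial>lebesgue) \<le> ennreal (\<eta> powr (q / p))"
      using eventually_happens'[OF sequentially_bot] by blast
    have t: "\<phi> k \<in> test_functions" using \<phi> by auto
    have [measurable]: "\<phi> k \<in> borel_measurable lebesgue" "grad (\<phi> k) \<in> borel_measurable lebesgue"
      using borel_measurable_continuous_onI[OF test_function_continuous[OF t]]
        borel_measurable_continuous_onI[OF test_function_grad_continuous[OF t]]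
      by (auto intro: measurable_completion)
    have "(\<integral>\<^sup>+x. ennreal (norm (grad (\<phi> k) x) powr p) \<partial>lebesgue)
        \<le> ennreal (2 powr p) * ((\<integral>\<^sup>+x. ennreal (norm (G x - grad (\<phi> k) x) powr p) \<partial>lebesgue) + ?I)"
      using p by (intro nn_integral_powr_quasi_triangle) auto
    also have "\<dots> \<le> ennreal (2 powr p) * (?I + ennreal \<eta>)"
      using k(1) by (intro mult_left_mono) (auto simp: norm_minus_commute add.commute intro: add_left_mono)
    finally have "epow (\<integral>\<^sup>+x. ennreal (norm (grad (\<phi> k) x) powr p) \<partial>lebesgue) (q / p)
        \<le> epow (ennreal (2 powr p) * (?I + ennreal \<eta>)) (q / p)"
      using p q by (intro epow_mono) auto
    also have "\<dots> = ennreal (2 powr q) * ?E"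
      using p q by (subst epow_cmult) (auto simp: powr_powr)
    finally have grad_le: "epow (\<integral>\<^sup>+x. ennreal (norm (grad (\<phi> k) x) powr p) \<partial>lebesgue) (q / p)
        \<le> ennreal (2 powr q) * ?E" .
    have "(\<integral>\<^sup>+x. ennreal (norm (\<phi> k x) powr q) \<partial>lebesgue)
        \<le> ennreal K0 * epow (\<integral>\<^sup>+x. ennreal (norm (grad (\<phi> k) x) powr p) \<partial>lebesgue) (q / p)"
      using Sobolev_test_function[OF t p] by (simp add: nn_integral_completion K0_def g_def q_def)
    also have "\<dots> \<le> ennreal K0 * (ennreal (2 powr q) * ?E)" using grad_le by (intro mult_left_mono) auto
    finally have phi_le: "(\<integral>\<^sup>+x. ennreal (norm (\<phi> k x) powr q) \<partial>lebesgue) \<le> ennreal (K0 * 2 powr q) * ?E"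
      using K by (simp add: ennreal_mult mult_ac)
    have "ennreal (\<eta> powr (q / p)) = epow (ennreal \<eta>) (q / p)"
      using \<open>0 < \<eta>\<close> p q by (simp add: epow_ennreal)
    also have "\<dots> \<le> ?E" using p q by (intro epow_mono) auto
    finally have eta_le: "(\<integral>\<^sup>+x. ennreal (norm (\<phi> k x - u x) powr q) \<partial>lebesgue) \<le> ?E" using k(2) by simp
    have "(\<integral>\<^sup>+x. ennreal (norm (u x) powr q) \<partial>lebesgue) \<le> ennreal (2 powr q) *
      ((\<integral>\<^sup>+x. ennreal (norm (\<phi> k x - u x) powr q) \<partial>lebesgue) + (\<integral>\<^sup>+x. ennreal (norm (\<phi> k x) powr q) \<partial>lebesgue))"
      using q by (intro nn_integral_powr_quasi_triangle) auto
    also have "\<dots> \<le> ennreal (2 powr q) * (?E + ennreal (K0 * 2 powr q) * ?E)"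
      by (intro mult_left_mono add_mono eta_le phi_le) auto
    also have "\<dots> = ennreal (2 powr q) * (ennreal (1 + K0 * 2 powr q) * ?E)"
      using K by (simp add: distrib_right)
    also have "\<dots> = ennreal K * ?E"
      using K by (simp add: K_def ennreal_mult mult_ac del: ennreal_plus)
    finally show "(\<integral>\<^sup>+x. ennreal (\<bar>u x\<bar> powr q) \<partial>lebesgue) \<le> ennreal K * ?E" by simp
  qed
qed

lemma gradient_power_integral_finite:
  assumes grad: "has_gradient p u G" and "0 < p"
  shows "(\<integral>\<^sup>+x. ennreal (norm (G x) powr p) \<partial>lebesgue) < \<infinity>"
proof -
  from grad obtain \<phi> where \<phi>: "range \<phi> \<subseteq> test_functions"
      and grad_lim: "(\<lambda>k. Lp_norm p (\<lambda>x. grad (\<phi> k) x - G x)) \<longlonglongrightarrow> 0"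
      and [measurable]: "G \<in> borel_measurable lebesgue"
    unfolding has_gradient_def by blast
  obtain k where k: "(\<integral>\<^sup>+x. ennreal (norm (grad (\<phi> k) x - G x) powr p) \<partial>lebesgue) \<le> ennreal 1"
    using eventually_happens'[OF sequentially_bot eventually_power_integral_le[OF grad_lim \<open>0 < p\<close>, of 1]] by auto
  have t: "\<phi> k \<in> test_functions" using \<phi> by auto
  have [measurable]: "grad (\<phi> k) \<in> borel_measurable lebesgue"
    using borel_measurable_continuous_onI[OF test_function_grad_continuous[OF t]]
    by (auto intro: measurable_completion)
  have "(\<integral>\<^sup>+x. ennreal (norm (G x) powr p) \<partial>lebesgue) \<le> ennreal (2 powr p) *
    ((\<integral>\<^sup>+x. ennreal (norm (grad (\<phi> k) x - G x) powr p) \<partial>lebesgue) + (\<integral>\<^sup>+x. ennreal (norm (grad (\<phi> k) x) powr p) \<partial>lebesgue))"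
    using \<open>0 < p\<close> by (intro nn_integral_powr_quasi_triangle) auto
  also have "\<dots> < \<infinity>"
    using k test_function_power_integral_finite(2)[OF t \<open>0 < p\<close>]
    by (auto simp: ennreal_mult_less_top nn_integral_completion less_top intro: le_less_trans)
  finally show ?thesis .
qed

section \<open>Rearrangements\<close>

lemma rearrangement_eq: "t > 0 \<Longrightarrow> rearrangement f t = Inf {ennreal s | s. s > 0 \<and> distribution_fun f s < ennreal t}"
  by (simp add: rearrangement_def)

lemma rearrangement_antimono:
  assumes "0 < s" "s \<le> t"
  shows "rearrangement f t \<le> rearrangement f s"
proof -
  have "distribution_fun f r < ennreal t" if "distribution_fun f r < ennreal s" for r
    using that ennreal_leI[OF assms(2)] by (rule less_le_trans)
  then show ?thesis
    using assms by (auto simp: rearrangement_eq intro!: Inf_superset_mono)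
qed

lemma rearrangement_le:
  assumes "0 < t" "0 < s" "distribution_fun f s < ennreal t"
  shows "rearrangement f t \<le> ennreal s"
  using assms by (auto simp: rearrangement_eq intro!: Inf_lower)

text \<open>The value \<open>top\<close> on the left of the origin extends the rearrangement to a decreasing function on
the whole line, so that its superlevel sets are intervals.\<close>
lemma rearrangement_measurable [measurable]:
  "(\<lambda>t. if 0 < t then rearrangement f t else top) \<in> borel_measurable borel" (is "?R \<in> _")
proof (rule borel_measurableI_greater)
  fix y
  have anti: "?R b \<le> ?R a" if "a \<le> b" for a b
    using that rearrangement_antimono[of a b f] by auto
  have "is_interval {t. y < ?R t}"
    unfolding is_interval_1 using anti by (blast intro: less_le_trans)
  then show "{t \<in> space borel. y < ?R t} \<in> sets borel"
    using real_interval_borel_measurable by simp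
qed

text \<open>Both sides are the measure of the region between the graph of \<open>f\<close> and the axis (the positive part
of \<open>f\<close> only), computed by integrating in either order.\<close>
lemma layer_cake:
  assumes "sigma_finite_measure M" and [measurable]: "f \<in> borel_measurable M"
  shows "(\<integral>\<^sup>+x. ennreal (f x) \<partial>M)
    = (\<integral>\<^sup>+s. emeasure M {x \<in> space M. s < f x} * indicator {0<..} s \<partial>lborel)"
proof -
  interpret M: sigma_finite_measure M by fact
  interpret pair_sigma_finite M "lborel :: real measure" ..
  have "(\<integral>\<^sup>+x. ennreal (f x) \<partial>M) = (\<integral>\<^sup>+x. emeasure lborel {0<..<f x} \<partial>M)"
  proof (intro nn_integral_cong)
    show "ennreal (f x) = emeasure lborel {0<..<f x}" for x
      by (cases "0 \<le> f x") (auto simp: ennreal_neg)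
  qed
  also have "\<dots> = (\<integral>\<^sup>+x. (\<integral>\<^sup>+s. indicator {(x, s). 0 < s \<and> s < f x} (x, s) \<partial>lborel) \<partial>M)"
    by (intro nn_integral_cong)
       (auto simp: nn_integral_indicator[symmetric] simp del: nn_integral_indicator intro!: nn_integral_cong split: split_indicator)
  also have "\<dots> = (\<integral>\<^sup>+s. (\<integral>\<^sup>+x. indicator {(x, s). 0 < s \<and> s < f x} (x, s) \<partial>M) \<partial>lborel)"
    by (intro Fubini'[symmetric]) measurable
  also have "\<dots> = (\<integral>\<^sup>+s. (\<integral>\<^sup>+x. indicator {0<..} s * indicator {x \<in> space M. s < f x} x \<partial>M) \<partial>lborel)"
    by (intro nn_integral_cong) (auto split: split_indicator)
  also have "\<dots> = (\<integral>\<^sup>+s. emeasure M {x \<in> space M. s < f x} * indicator {0<..} s \<partial>lborel)"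
    by (intro nn_integral_cong) (simp add: nn_integral_cmult mult.commute)
  finally show ?thesis .
qed

lemma sigma_finite_lebesgue: "sigma_finite_measure (lebesgue :: 'a::euclidean_space measure)"
proof
  obtain A :: "nat \<Rightarrow> 'a set" where A: "range A \<subseteq> sets lborel" "(\<Union>i. A i) = space lborel" "\<And>i. emeasure lborel (A i) \<noteq> \<infinity>"
    using lborel.sigma_finite by metis
  show "\<exists>A :: 'a set set. countable A \<and> A \<subseteq> sets lebesgue \<and> \<Union>A = space lebesgue \<and> (\<forall>a\<in>A. emeasure lebesgue a \<noteq> \<infinity>)"
    by (rule exI[of _ "range A"]) (use A in \<open>auto simp: emeasure_completion\<close>)
qed

text \<open>The superlevel set of the rearrangement at height \<open>r\<close> is an interval starting at 0 whose length is
at most the distribution function of \<open>u\<close> at \<open>r\<close>. By the layer cake formula, one half of the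
equimeasurability of \<open>u\<close> and its rearrangement follows, and it is the half that is needed for
an upper bound.\<close>
lemma rearrangement_power_integral_le:
  fixes u :: "real ^ 'n \<Rightarrow> real"
  assumes [measurable]: "u \<in> borel_measurable lebesgue" and "0 < q"
  shows "(\<integral>\<^sup>+t. ennreal (indicator {0<..} t * enn2real (rearrangement u t) powr q) \<partial>lborel)
    \<le> (\<integral>\<^sup>+x. ennreal (\<bar>u x\<bar> powr q) \<partial>lebesgue)"
proof -
  define H where "H t = indicator {0<..} t * enn2real (rearrangement u t) powr q" for t
  have "H = (\<lambda>t. indicator {0<..} t * enn2real (if 0 < t then rearrangement u t else top) powr q)"
    by (auto simp: H_def fun_eq_iff)
  also have "\<dots> \<in> borel_measurable borel" by measurable
  finally have [measurable]: "H \<in> borel_measurable borel" .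
  have "emeasure lborel {t. s < H t} \<le> emeasure lebesgue {x. s < \<bar>u x\<bar> powr q}" if "0 < s" for s
  proof -
    define r where "r = s powr (1 / q)"
    have r: "0 < r" "r powr q = s" using that \<open>0 < q\<close> by (auto simp: r_def powr_powr)
    have root: "s < y powr q \<longleftrightarrow> r < y" if "0 \<le> y" for y
    proof -
      have "y powr q \<le> r powr q" if "y \<le> r" using that \<open>0 \<le> y\<close> \<open>0 < q\<close> by (intro powr_mono2) auto
      moreover have "r powr q < y powr q" if "r < y" using that r \<open>0 < q\<close> by (intro powr_less_mono2) auto
      ultimately show ?thesis unfolding r(2) by force
    qed
    have "{x. s < \<bar>u x\<bar> powr q} = {x. r < \<bar>u x\<bar>}" using root by auto
    then have eq: "emeasure lebesgue {x. s < \<bar>u x\<bar> powr q} = distribution_fun u r"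
      by (simp add: distribution_fun_def)
    have sub: "0 < t \<and> ennreal t \<le> distribution_fun u r" if "s < H t" for t
    proof -
      have "0 < t" using that \<open>0 < s\<close> by (auto simp: H_def split: split_indicator_asm)
      then have "r < enn2real (rearrangement u t)" using that root by (simp add: H_def)
      then have "ennreal r < rearrangement u t"
        using r by (cases "rearrangement u t") (auto simp: ennreal_less_iff)
      then show ?thesis using rearrangement_le[OF \<open>0 < t\<close> r(1), of u] \<open>0 < t\<close> by (auto simp: not_less[symmetric])
    qed
    show ?thesis
    proof (cases "distribution_fun u r")
      case (real \<alpha>)
      then have "{t. s < H t} \<subseteq> {0..\<alpha>}" using sub by force
      then have "emeasure lborel {t. s < H t} \<le> emeasure lborel {0..\<alpha>}" by (rule emeasure_mono) simp
      then show ?thesis using real by (simp add: eq)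
    qed (simp add: eq)
  qed
  then have "(\<integral>\<^sup>+t. ennreal (H t) \<partial>lborel) \<le> (\<integral>\<^sup>+x. ennreal (\<bar>u x\<bar> powr q) \<partial>lebesgue)"
    by (subst (1 2) layer_cake)
       (auto intro!: nn_integral_mono sigma_finite_lebesgue lborel.sigma_finite_measure_axioms split: split_indicator)
  then show ?thesis by (simp add: H_def)
qed

section \<open>The logarithmic inequality\<close>

text \<open>The positive part of \<open>\<psi>\<close> is dominated by an integrable function. So either the negative part has an
infinite integral and the extended integral is \<open>-\<infinity>\<close>, or \<open>\<psi>\<close> is integrable and integrals
are monotone.\<close>
lemma ext_integral_le_set_integral:
  fixes \<psi> \<Phi> :: "real \<Rightarrow> real"
  assumes meas [measurable]: "(\<lambda>s. indicator A s * \<psi> s) \<in> borel_measurable borel"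
    and int: "integrable lborel (\<lambda>s. indicator A s * \<Phi> s)"
    and le: "\<And>s. s \<in> A \<Longrightarrow> \<psi> s \<le> \<Phi> s"
  shows "ext_integral A \<psi> \<le> ereal (\<integral>s. indicator A s * \<Phi> s \<partial>lborel)"
proof -
  define \<psi>' where "\<psi>' s = indicator A s * \<psi> s" for s
  define P where "P = (\<integral>\<^sup>+s. ennreal (\<psi>' s) \<partial>lborel)"
  define N where "N = (\<integral>\<^sup>+s. ennreal (- \<psi>' s) \<partial>lborel)"
  have [measurable]: "\<psi>' \<in> borel_measurable borel" using meas by (simp add: \<psi>'_def[abs_def])
  have E: "ext_integral A \<psi> = enn2ereal P - enn2ereal N"
    unfolding ext_integral_def P_def N_def
    by (intro arg_cong2[where f="(-)"] arg_cong[where f=enn2ereal] nn_integral_cong)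
       (auto simp: \<psi>'_def split: split_indicator)
  have le': "\<psi>' s \<le> indicator A s * \<Phi> s" for s
    using le by (auto simp: \<psi>'_def split: split_indicator)
  have "P \<le> (\<integral>\<^sup>+s. ennreal (norm (indicator A s * \<Phi> s)) \<partial>lborel)"
    unfolding P_def using le' by (intro nn_integral_mono ennreal_leI) (metis abs_ge_self order_trans real_norm_def)
  also have "\<dots> < \<infinity>" using int by (simp add: integrable_iff_bounded)
  finally have P: "P < \<infinity>" .
  show ?thesis
  proof (cases "N = \<infinity>")
    case True
    then have "ext_integral A \<psi> = -\<infinity>" using P by (cases P) (auto simp: E)
    then show ?thesis by simp
  next
    case False
    have "integrable lborel \<psi>'"
      using P False by (intro real_integrable_def[THEN iffD2]) (auto simp: P_def N_def)
    then have "(\<integral>s. \<psi>' s \<partial>lborel) \<le> (\<integral>s. indicator A s * \<Phi> s \<partial>lborel)"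
      using int le' by (intro integral_mono) auto
    moreover have "(\<integral>s. \<psi>' s \<partial>lborel) = enn2real P - enn2real N"
      unfolding P_def N_def by (rule real_lebesgue_integral_def) fact
    moreover have "ext_integral A \<psi> = ereal (enn2real P - enn2real N)"
      using P False by (cases P; cases N) (auto simp: E)
    ultimately show ?thesis by simp
  qed
qed

text \<open>A pointwise form of Jensen's inequality: the graph of \<open>ln\<close> lies below its tangent at \<open>K\<close>, and
this is evaluated at \<open>(t * w) powr a\<close>. A pointwise bound passes to extended integrals, which may
be \<open>-\<infinity>\<close>. If \<open>w\<close> is a probability density in the variable \<open>t\<close>, and \<open>K\<close> is at least the integral
of \<open>(t * w) powr a * w\<close>, the right-hand side integrates to at most \<open>ln K / a\<close>.\<close>
lemma weighted_log_le:
  fixes w :: real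
  assumes "0 \<le> w" "0 < K" "0 < a" "0 < t"
  shows "w * ln (t * w) \<le> (1 / a) * ((ln K - 1) * w + (t * w) powr a * w / K)"
proof (cases "w = 0")
  case False
  then have w: "0 < w" "0 < t * w" using assms by auto
  then have x: "0 < (t * w) powr a / K" using assms by simp
  have "a * ln (t * w) - ln K = ln ((t * w) powr a / K)"
    using w assms by (simp add: ln_div ln_powr)
  also have "\<dots> \<le> (t * w) powr a / K - 1" using ln_le_minus_one[OF x] .
  finally have "w * (a * ln (t * w)) \<le> w * (ln K - 1 + (t * w) powr a / K)"
    using w by (intro mult_left_mono) auto
  then show ?thesis using \<open>0 < a\<close> by (simp add: field_simps)
qed simp

text \<open>The Lorentz quasi-norm being finite, the rearrangement is finite almost everywhere, so its real
value can stand for it under the integral.\<close>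
lemma weighted_rearrangement_integral_eq_1:
  fixes u :: "real ^ 'n \<Rightarrow> real"
  assumes "0 < p" and "lorentz_norm q p u = 1"
  shows "(\<integral>\<^sup>+t. ennreal (indicator {0<..} t * (t powr (p / q - 1) * enn2real (rearrangement u t) powr p)) \<partial>lborel) = 1"
proof -
  let ?R = "\<lambda>t. if 0 < t then rearrangement u t else top"
  let ?f = "\<lambda>t. ennreal_powr (ennreal (t powr (1 / q - 1 / p)) * rearrangement u t) p * indicator {0<..} t"
  let ?I = "\<integral>\<^sup>+t. ?f t \<partial>lborel"
  have I: "?I = 1"
  proof (cases ?I)
    case (real i)
    with assms have "i powr (1 / p) = 1"
      by (simp add: lorentz_norm_def ennreal_powr_def)
    then have "(i powr (1 / p)) powr p = 1" by simp
    then show ?thesis using real assms(1) by (simp add: powr_powr)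
  qed (use assms in \<open>simp add: lorentz_norm_def ennreal_powr_def\<close>)
  have "?f = (\<lambda>t. epow (ennreal (t powr (1 / q - 1 / p)) * ?R t) p * indicator {0<..} t)"
    using \<open>0 < p\<close> by (auto simp: fun_eq_iff epow_def split: split_indicator)
  also have "\<dots> \<in> borel_measurable lborel" by measurable
  finally have m: "?f \<in> borel_measurable lborel" .
  have "AE t in lborel. ?f t \<noteq> \<infinity>" using I by (intro nn_integral_noteq_infinite m) simp
  then have "AE t in lborel. ?f t = ennreal (indicator {0<..} t * (t powr (p / q - 1) * enn2real (rearrangement u t) powr p))"
  proof eventually_elim
    case (elim t)
    show ?case
    proof (cases "0 < t")
      case True
      then have "rearrangement u t \<noteq> top"
        using elim \<open>0 < p\<close> by (auto simp: ennreal_mult_top ennreal_powr_def)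
      then obtain r where r: "rearrangement u t = ennreal r" "0 \<le> r" by (cases "rearrangement u t") auto
      have e: "(1 / q - 1 / p) * p = p / q - 1" using \<open>0 < p\<close> by (simp add: field_simps)
      show ?thesis using True r \<open>0 < p\<close>
        by (simp add: ennreal_powr_def ennreal_mult[symmetric] powr_mult powr_powr e)
    qed simp
  qed
  from nn_integral_cong_AE[OF this] I show ?thesis by simp
qed

theorem theorem1p5:
  fixes p :: real
  assumes "CARD('n::finite) \<ge> 3" and "1 < p" and "p < real CARD('n)"
  shows "\<exists>C>0. \<forall>u \<in> (beppo_levi p :: (real ^ 'n \<Rightarrow> real) set). \<forall>G.
    has_gradient p u G \<longrightarrow> lorentz_norm (sobolev_exponent CARD('n) p) p u = 1 \<longrightarrow>
    ext_integral {0<..} (log_integrand CARD('n) p u)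
      \<le> ereal (real CARD('n) / p * ln (C * (\<integral>x. norm (G x) powr p \<partial>lebesgue)))"
proof -
  define n where "n = real CARD('n)"
  define q where "q = sobolev_exponent CARD('n) p"
  define a where "a = p / (n - p)"
  have n: "1 < p" "p < n" using assms by (auto simp: n_def)
  have q_eq: "q = n * p / (n - p)" by (simp add: q_def sobolev_exponent_def n_def)
  have q: "0 < q" "p / q = 1 - p / n" "p * (1 + a) = q" "(p / q) * (1 + a) = 1" "q / p = n / (n - p)"
    using n by (auto simp: q_eq a_def field_simps)
  have a: "0 < a" using n by (simp add: a_def)
  from Sobolev_inequality[OF assms(2,3)] obtain S where "0 < S" and
    S: "\<And>(u :: real ^ 'n \<Rightarrow> real) G \<eta>. 0 < \<eta> \<Longrightarrow> u \<in> borel_measurable lebesgue \<Longrightarrow> has_gradient p u G \<Longrightarrow>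
    (\<integral>\<^sup>+x. ennreal (\<bar>u x\<bar> powr q) \<partial>lebesgue)
      \<le> ennreal S * epow ((\<integral>\<^sup>+x. ennreal (norm (G x) powr p) \<partial>lebesgue) + ennreal \<eta>) (q / p)"
    unfolding q_def by blast
  \<comment> \<open>The factor 2 comes from the choice \<eta> = i below, the exponent of S from 1 / a = n / p * (1 - p / n).\<close>
  define C where "C = 2 * S powr (1 - p / n)"
  have "0 < C" using \<open>0 < S\<close> by (simp add: C_def)
  moreover have "ext_integral {0<..} (log_integrand CARD('n) p u)
      \<le> ereal (real CARD('n) / p * ln (C * (\<integral>x. norm (G x) powr p \<partial>lebesgue)))"
    if u: "u \<in> beppo_levi p" and G: "has_gradient p u G" and norm1: "lorentz_norm q p u = 1"
    for u :: "real ^ 'n \<Rightarrow> real" and G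
  proof -
    have [measurable]: "u \<in> borel_measurable lebesgue" using u by (simp add: beppo_levi_def)
    have [measurable]: "G \<in> borel_measurable lebesgue" using G by (simp add: has_gradient_def)
    define v where "v t = enn2real (rearrangement u t)" for t
    define w where "w t = t powr (p / q - 1) * v t powr p" for t
    have "(\<lambda>t. indicator {0<..} t * v t)
        = (\<lambda>t. indicator {0<..} t * enn2real (if 0 < t then rearrangement u t else top))"
      by (auto simp: v_def fun_eq_iff)
    also have "\<dots> \<in> borel_measurable borel" by measurable
    finally have v [measurable]: "(\<lambda>t. indicator {0<..} t * v t) \<in> borel_measurable borel" .
    have w0: "0 \<le> w t" for t by (simp add: w_def)
    have meas: "(\<lambda>t. indicator {0<..} t * F t (v t)) \<in> borel_measurable borel"
      if [measurable]: "(\<lambda>(t, y). F t y) \<in> borel_measurable (borel \<Otimes>\<^sub>M borel)" for F :: "real \<Rightarrow> real \<Rightarrow> real"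
    proof -
      have "(\<lambda>t. indicator {0<..} t * F t (v t)) = (\<lambda>t. indicator {0<..} t * F t (indicator {0<..} t * v t))"
        by (auto simp: fun_eq_iff split: split_indicator)
      also have "\<dots> \<in> borel_measurable borel" by measurable
      finally show ?thesis .
    qed
    \<comment> \<open>W is the density of a probability measure, by the normalization of u; V is what
      Jensen's inequality with respect to this measure produces.\<close>
    define W where "W t = indicator {0<..} t * w t" for t
    define V where "V t = indicator {0<..} t * v t powr q" for t
    have [measurable]: "W \<in> borel_measurable borel" "V \<in> borel_measurable borel"
      unfolding W_def[abs_def] w_def V_def[abs_def] by (rule meas; measurable)+
    have W0: "0 \<le> W t" and V0: "0 \<le> V t" for t by (simp_all add: W_def V_def w0)
    have W1: "(\<integral>\<^sup>+t. ennreal (W t) \<partial>lborel) = 1"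
      using weighted_rearrangement_integral_eq_1[OF _ norm1] n by (simp add: W_def w_def v_def)
    have W: "integrable lborel W" "(\<integral>t. W t \<partial>lborel) = 1"
      using W1 W0 by (auto intro!: integrableI_nonneg simp: integral_eq_nn_integral)
    have V_le: "(\<integral>\<^sup>+t. ennreal (V t) \<partial>lborel) \<le> (\<integral>\<^sup>+x. ennreal (\<bar>u x\<bar> powr q) \<partial>lebesgue)"
      using rearrangement_power_integral_le[of u q] q by (simp add: V_def v_def)
    have wv: "(t * w t) powr a * w t = v t powr q" if "0 < t" for t
    proof -
      have "t * w t = t powr (p / q) * v t powr p"
        using that by (simp add: w_def powr_diff)
      then have "(t * w t) powr a = t powr (p / q * a) * v t powr (p * a)"
        by (simp only: powr_mult powr_powr)
      then have "(t * w t) powr a * w t = (t powr (p / q * a) * t powr (p / q - 1)) * (v t powr (p * a) * v t powr p)"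
        by (simp only: w_def mult_ac)
      also have "\<dots> = t powr (p / q * (1 + a) - 1) * v t powr (p * (1 + a))"
        using that by (simp add: powr_add[symmetric] algebra_simps add_divide_distrib)
      also have "\<dots> = v t powr q" using q that by simp
      finally show ?thesis .
    qed
    define I where "I = (\<integral>\<^sup>+x. ennreal (norm (G x) powr p) \<partial>lebesgue)"
    have "I < \<infinity>" unfolding I_def using G n by (intro gradient_power_integral_finite) auto
    then obtain i where i: "I = ennreal i" "0 \<le> i" by (cases I) auto
    have iG: "(\<integral>x. norm (G x) powr p \<partial>lebesgue) = i"
      using i by (subst integral_eq_nn_integral) (auto simp: I_def[symmetric])
    \<comment> \<open>A vanishing gradient would force u to vanish, against the normalization.\<close>
    have "i \<noteq> 0"
    proof
      assume "i = 0"
      have "(\<integral>\<^sup>+t. ennreal (V t) \<partial>lborel) \<le> 0 + ennreal e" if "0 < e" for e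
      proof -
        \<comment> \<open>The solution of S * \<eta> powr (q / p) = e.\<close>
        define \<eta> where "\<eta> = (e / S) powr (p / q)"
        have "0 < \<eta>" "\<eta> powr (q / p) = e / S" using that \<open>0 < S\<close> q n by (auto simp: \<eta>_def powr_powr)
        then have "ennreal S * epow (I + ennreal \<eta>) (q / p) = ennreal e"
          using i \<open>i = 0\<close> q n \<open>0 < S\<close> that by (simp add: epow_ennreal ennreal_mult[symmetric])
        then show ?thesis using order_trans[OF V_le S[OF \<open>0 < \<eta>\<close> _ G]] by (simp add: I_def)
      qed
      then have "(\<integral>\<^sup>+t. ennreal (V t) \<partial>lborel) = 0"
        using ennreal_le_epsilon[of 0 "\<integral>\<^sup>+t. ennreal (V t) \<partial>lborel"] by simp
      then have "AE t in lborel. ennreal (V t) = 0" by (subst (asm) nn_integral_0_iff_AE) auto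
      then have "AE t in lborel. ennreal (W t) = 0"
        by eventually_elim (auto simp: V_def W_def w_def ennreal_eq_0_iff split: split_indicator_asm split_indicator)
      then have "(\<integral>\<^sup>+t. ennreal (W t) \<partial>lborel) = 0" by (subst nn_integral_0_iff_AE) auto
      with W1 show False by simp
    qed
    then have "0 < i" using i by simp
    \<comment> \<open>The bound of the Sobolev inequality with \<eta> equal to the integral i itself.\<close>
    define K where "K = S * (2 * i) powr (q / p)"
    have "0 < K" using \<open>0 < S\<close> \<open>0 < i\<close> by (simp add: K_def)
    have "I + ennreal i = ennreal (2 * i)"
      using i by (simp add: ennreal_plus[symmetric] del: ennreal_plus)
    moreover have "epow (ennreal (2 * i)) (q / p) = ennreal ((2 * i) powr (q / p))"
      using q(1) n i by (intro epow_ennreal) auto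
    ultimately have "ennreal S * epow (I + ennreal i) (q / p) = ennreal K"
      using \<open>0 < S\<close> by (simp add: K_def ennreal_mult)
    then have VK: "(\<integral>\<^sup>+t. ennreal (V t) \<partial>lborel) \<le> ennreal K"
      using order_trans[OF V_le S[OF \<open>0 < i\<close> _ G]] by (simp add: I_def)
    have V: "integrable lborel V"
      using VK by (intro integrableI_nonneg) (auto simp: V0 intro: le_less_trans)
    have V2: "(\<integral>t. V t \<partial>lborel) \<le> K"
      using VK \<open>0 < K\<close> by (subst integral_eq_nn_integral) (auto simp: V0 enn2real_leI)
    define \<Phi> where "\<Phi> t = (1 / a) * ((ln K - 1) * w t + v t powr q / K)" for t
    have \<Phi>: "(\<lambda>t. indicator {0<..} t * \<Phi> t) = (\<lambda>t. (1 / a) * ((ln K - 1) * W t + V t / K))"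
      by (auto simp: fun_eq_iff \<Phi>_def W_def V_def split: split_indicator)
    have log: "log_integrand CARD('n) p u t = w t * ln (t * w t)" if "0 < t" for t
    proof -
      have tw: "t * w t = t powr (1 - p / n) * v t powr p"
        using that by (simp add: w_def powr_diff powr_minus q(2) field_simps)
      show ?thesis unfolding tw by (simp add: log_integrand_def w_def v_def n_def q_def)
    qed
    have "ext_integral {0<..} (log_integrand CARD('n) p u) \<le> ereal (\<integral>t. indicator {0<..} t * \<Phi> t \<partial>lborel)"
    proof (rule ext_integral_le_set_integral)
      have "(\<lambda>t. indicator {0<..} t * log_integrand CARD('n) p u t) = (\<lambda>t. W t * ln (t * W t))"
        by (auto simp: fun_eq_iff W_def log split: split_indicator)
      then show "(\<lambda>t. indicator {0<..} t * log_integrand CARD('n) p u t) \<in> borel_measurable borel"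
        by simp
      show "integrable lborel (\<lambda>t. indicator {0<..} t * \<Phi> t)" unfolding \<Phi> using W V by auto
      show "log_integrand CARD('n) p u t \<le> \<Phi> t" if "t \<in> {0<..}" for t
        using weighted_log_le[OF w0 \<open>0 < K\<close> a, of t t] that by (simp add: \<Phi>_def log wv)
    qed
    also have "(\<integral>t. indicator {0<..} t * \<Phi> t \<partial>lborel) = (1 / a) * ((ln K - 1) * 1 + (\<integral>t. V t \<partial>lborel) / K)"
      unfolding \<Phi> using W V by simp
    also have "\<dots> \<le> (1 / a) * ((ln K - 1) * 1 + 1)"
      using V2 a \<open>0 < K\<close> by (intro mult_left_mono add_left_mono) auto
    also have "\<dots> = n / p * ln (C * i)"
    proof -
      have "ln K = ln S + n / (n - p) * ln (2 * i)"
        using \<open>0 < S\<close> \<open>0 < i\<close> by (simp add: K_def ln_mult ln_powr q(5))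
      moreover have "ln (C * i) = (1 - p / n) * ln S + ln (2 * i)"
        using \<open>0 < S\<close> \<open>0 < i\<close> by (simp add: C_def ln_mult ln_powr)
      moreover have "1 / a = n / p * (1 - p / n)" "1 / a * (n / (n - p)) = n / p"
        using n by (auto simp: a_def field_simps)
      moreover have "(1 / a) * ((ln K - 1) * 1 + 1) = 1 / a * ln K" by simp
      ultimately show ?thesis by (simp only: distrib_left mult.assoc[symmetric])
    qed
    finally show ?thesis by (simp add: iG n_def)
  qed
  ultimately show ?thesis unfolding q_def by blast
qed

end
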